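(* Let $S$ be consistent. Then neither $A_{q}(\lceil q\rceil)$ nor its negation $\neg A_{q}(\lceil q\rceil)$ is provable in $S$, where $A_q(\lceil q\rceil)$ is the Rosser formula $$A_{q}(\lceil q\rceil)=\forall b\,\bigl(g(\lceil q\rceil,b)\Rightarrow\exists c\,(c\le b\wedge h(\lceil q\rceil,c))\bigr).$$
   Context: **Formal number theory $S$.** Primitive symbols: $\Rightarrow,\wedge,\lor,\neg,\forall,\exists$; the predicate symbol $=$; the function symbols $+$, $\cdot$, ${}'$ (successor); the object symbol $0$; variables; parentheses; comma. Terms: $0$, variables, and $(s)'$, $(s)+(t)$, $(s)\cdot(t)$ for terms $s,t$. Formulae: $(s)=(t)$ for terms $s,t$, and $(A)\Rightarrow(B)$, $(A)\wedge(B)$, $(A)\lor(B)$, $\neg(A)$, $\forall x(A)$, $\exists x(A)$ for formulae $A,B$ and variables $x$. Rules of inference ($C$ does not contain $x$): from $A$ and $A\Rightarrow B$ infer $B$; from $C\Rightarrow F$ infer $C\Rightarrow\forall xF$; from $F\Rightarrow C$ infer $\exists xF\Rightarrow C$. Axioms: A1 (propositional; $A,B,C$ arbitrary formulae): $A\Rightarrow(B\Rightarrow A)$; $(A\Rightarrow B)\Rightarrow((A\Rightarrow(B\Rightarrow C))\Rightarrow(A\Rightarrow C))$; $A\Rightarrow((A\Rightarrow B)\Rightarrow B)$; $A\Rightarrow(B\Rightarrow A\wedge B)$; $A\wedge B\Rightarrow A$; $A\wedge B\Rightarrow B$; $A\Rightarrow A\lor B$; $B\Rightarrow A\lor B$;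 $(A\Rightarrow C)\Rightarrow((B\Rightarrow C)\Rightarrow(A\lor B\Rightarrow C))$; $(A\Rightarrow B)\Rightarrow((A\Rightarrow\neg B)\Rightarrow\neg A)$; $\neg\neg A\Rightarrow A$. A2 (predicate; $A$ arbitrary, $B$ does not contain $x$ free, $t$ is free for $x$ in $F(x)$): $(B\Rightarrow A)\Rightarrow(B\Rightarrow\forall xA)$ (labelled "a rule of inference"); $\forall xF(x)\Rightarrow F(t)$; $F(t)\Rightarrow\exists xF(x)$; $(A\Rightarrow B)\Rightarrow((\exists xA)\Rightarrow B)$ (labelled "a rule of inference"). A3 ($a,b,c$ arbitrary variables): $a'=b'\Rightarrow a=b$; $\neg(a'=0)$; $a=b\Rightarrow(a=c\Rightarrow b=c)$; $a=b\Rightarrow a'=b'$; $a+0=a$; $a+b'=(a+b)'$; $a\cdot0=0$; $a\cdot b'=a\cdot b+a$. A4 ($F$ arbitrary): $(F(0)\wedge\forall x(F(x)\Rightarrow F(x')))\Rightarrow\forall xF(x)$. A proof is a finite sequence of formulae, consecutive ones separated by a comma, each of which is an axiom or follows from earlier ones by a rule of inference; it is a proof of its last formula, which is then provable, written $\vdash$. $S$ is consistent if there is no formula $B$ such that both $B$ and $\neg B$ are provable. $t_1\le t_2$ abbreviates $\exists x(t_1+x=t_2)$. **Gödel numbering.** The symbols ${}'\ 0\ (\ )\ \{\ \}\ [\ ]\ +\ \cdot\ =\ \Rightarrow\ \wedge\ \lor\ \neg\ \forall\ \exists\ ,$ receive the numbers $2^0,2^1,\dots,2^{17}$ in this order. The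 variables $a,b,c,\dots$ are written $(0'),(0''),(0'''),\dots$. The empty expression gets $0$, and a concatenation $A_1A_2$ of expressions gets $n\star m$, where $n,m$ are the Gödel numbers of $A_1,A_2$, $n\star m=2^{\ell(m)}n+m$, and $\ell(m)$ is the number of binary digits of $m$ (with $\ell(0)=0$). $A_n$ (resp. $E_n$) denotes the formula (resp. expression) with Gödel number $n$. **Numerals and substitution.** $\lceil n\rceil$ is the numeral $0^{\prime\prime\cdots\prime}$ with $n$ primes. For a formula $F$ and a variable $x$, $F(\lceil n\rceil)$ is defined as $\forall x(x=\lceil n\rceil\Rightarrow F)$. **The predicates.** For natural numbers $a,b$: - $\mathbf{G}(a,b)$: the formula $A_a$ with Gödel number $a$ has just one free variable $x$, and the expression $E_b$ with Gödel number $b$ is a proof of the formula $A_a(\lceil a\rceil)$ obtained from $A_a(x)$ by substituting $\lceil a\rceil$ into $x$. - $\mathbf{H}(a,b)$: the formula $A_a$ has just one free variable $x$, and $E_b$ is a proof of the formula $\neg A_a(\lceil a\rceil)$. The formulae $g(a,b)$ and $h(a,b)$ are formulae of $S$ with exactly the free variables $a,b$ that numeralwise express $\mathbf{G}$ and $\mathbf{H}$ in $S$: for all natural numbers $a,b$, if $\mathbf{G}(a,b)$ is true then $\vdash g(\lceil a\rceil,\lceil b\rceil)$, and if $\mathbf{G}(a,b)$ is false then $\vdash\neg g(\lceil a\rceil,\lceil b\rceil)$; similarly for $\mathbf{H}$ and $h$. **Rosser formula.** $q$ is the Gödel number of the formula $A_q(a)=\forall b\,(g(a,b)\Rightarrow\exists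 c\,(c\le b\wedge h(a,c)))$. In the formula $A_q(\lceil q\rceil)$, $g(\lceil q\rceil,b)=\forall a(a=\lceil q\rceil\Rightarrow g(a,b))$ and $h(\lceil q\rceil,c)=\forall a(a=\lceil q\rceil\Rightarrow h(a,c))$. *)

theory Defs
  imports "HOL-Library.Log_Nat"
begin

section \<open>Syntax of the formal number theory S\<close>

type_synonym var = nat

datatype tm =
    Zero
  | Var var
  | Succ tm
  | Plus tm tm
  | Times tm tm

datatype fm =
    Eq tm tm  (infix "\<^bold>=" 60)
  | Imp fm fm  (infixr "\<^bold>\<Rightarrow>" 52)
  | And fm fm  (infixr "\<^bold>\<and>" 56)
  | Or fm fm  (infixr "\<^bold>\<or>" 54)
  | Neg fm
  | All var fm
  | Ex var fm

primrec tvars :: "tm \<Rightarrow> var set" where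
  "tvars Zero = {}"
| "tvars (Var x) = {x}"
| "tvars (Succ s) = tvars s"
| "tvars (Plus s t) = tvars s \<union> tvars t"
| "tvars (Times s t) = tvars s \<union> tvars t"

primrec fv :: "fm \<Rightarrow> var set" where
  "fv (s \<^bold>= t) = tvars s \<union> tvars t"
| "fv (A \<^bold>\<Rightarrow> B) = fv A \<union> fv B"
| "fv (A \<^bold>\<and> B) = fv A \<union> fv B"
| "fv (A \<^bold>\<or> B) = fv A \<union> fv B"
| "fv (Neg A) = fv A"
| "fv (All y A) = fv A - {y}"
| "fv (Ex y A) = fv A - {y}"

primrec tsubst :: "var \<Rightarrow> tm \<Rightarrow> tm \<Rightarrow> tm" where
  "tsubst x r Zero = Zero"
| "tsubst x r (Var y) = (if y = x then r else Var y)"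
| "tsubst x r (Succ s) = Succ (tsubst x r s)"
| "tsubst x r (Plus s t) = Plus (tsubst x r s) (tsubst x r t)"
| "tsubst x r (Times s t) = Times (tsubst x r s) (tsubst x r t)"

text \<open>Literal replacement of the free occurrences of a variable. It may capture variables;
  the condition that a term is free for a variable is stated separately.\<close>

primrec subst :: "var \<Rightarrow> tm \<Rightarrow> fm \<Rightarrow> fm" where
  "subst x r (s \<^bold>= t) = (tsubst x r s \<^bold>= tsubst x r t)"
| "subst x r (A \<^bold>\<Rightarrow> B) = (subst x r A \<^bold>\<Rightarrow> subst x r B)"
| "subst x r (A \<^bold>\<and> B) = (subst x r A \<^bold>\<and> subst x r B)"
| "subst x r (A \<^bold>\<or> B) = (subst x r A \<^bold>\<or> subst x r B)"
| "subst x r (Neg A) = Neg (subst x r A)"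
| "subst x r (All y A) = All y (if y = x then A else subst x r A)"
| "subst x r (Ex y A) = Ex y (if y = x then A else subst x r A)"

primrec free_for :: "tm \<Rightarrow> var \<Rightarrow> fm \<Rightarrow> bool" where
  "free_for r x (s \<^bold>= t) \<longleftrightarrow> True"
| "free_for r x (A \<^bold>\<Rightarrow> B) \<longleftrightarrow> free_for r x A \<and> free_for r x B"
| "free_for r x (A \<^bold>\<and> B) \<longleftrightarrow> free_for r x A \<and> free_for r x B"
| "free_for r x (A \<^bold>\<or> B) \<longleftrightarrow> free_for r x A \<and> free_for r x B"
| "free_for r x (Neg A) \<longleftrightarrow> free_for r x A"
| "free_for r x (All y A) \<longleftrightarrow> x \<notin> fv (All y A) \<or> (y \<notin> tvars r \<and> free_for r x A)"
| "free_for r x (Ex y A) \<longleftrightarrow> x \<notin> fv (Ex y A) \<or> (y \<notin> tvars r \<and> free_for r x A)"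


section \<open>Axioms, rules of inference and proofs\<close>

text \<open>In the induction schema \<open>F(x')\<close> needs no side condition: no free occurrence of \<open>x\<close>
  in \<open>F\<close> lies in the scope of a quantifier binding \<open>x\<close>.\<close>

inductive ax :: "fm \<Rightarrow> bool" where
  "ax (A \<^bold>\<Rightarrow> (B \<^bold>\<Rightarrow> A))"
| "ax ((A \<^bold>\<Rightarrow> B) \<^bold>\<Rightarrow> ((A \<^bold>\<Rightarrow> (B \<^bold>\<Rightarrow> C)) \<^bold>\<Rightarrow> (A \<^bold>\<Rightarrow> C)))"
| "ax (A \<^bold>\<Rightarrow> ((A \<^bold>\<Rightarrow> B) \<^bold>\<Rightarrow> B))"
| "ax (A \<^bold>\<Rightarrow> (B \<^bold>\<Rightarrow> (A \<^bold>\<and> B)))"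
| "ax ((A \<^bold>\<and> B) \<^bold>\<Rightarrow> A)"
| "ax ((A \<^bold>\<and> B) \<^bold>\<Rightarrow> B)"
| "ax (A \<^bold>\<Rightarrow> (A \<^bold>\<or> B))"
| "ax (B \<^bold>\<Rightarrow> (A \<^bold>\<or> B))"
| "ax ((A \<^bold>\<Rightarrow> C) \<^bold>\<Rightarrow> ((B \<^bold>\<Rightarrow> C) \<^bold>\<Rightarrow> ((A \<^bold>\<or> B) \<^bold>\<Rightarrow> C)))"
| "ax ((A \<^bold>\<Rightarrow> B) \<^bold>\<Rightarrow> ((A \<^bold>\<Rightarrow> Neg B) \<^bold>\<Rightarrow> Neg A))"
| "ax (Neg (Neg A) \<^bold>\<Rightarrow> A)"
| "free_for t x F \<Longrightarrow> ax (All x F \<^bold>\<Rightarrow> subst x t F)"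
| "free_for t x F \<Longrightarrow> ax (subst x t F \<^bold>\<Rightarrow> Ex x F)"
| "ax ((Succ (Var a) \<^bold>= Succ (Var b)) \<^bold>\<Rightarrow> (Var a \<^bold>= Var b))"
| "ax (Neg (Succ (Var a) \<^bold>= Zero))"
| "ax ((Var a \<^bold>= Var b) \<^bold>\<Rightarrow> ((Var a \<^bold>= Var c) \<^bold>\<Rightarrow> (Var b \<^bold>= Var c)))"
| "ax ((Var a \<^bold>= Var b) \<^bold>\<Rightarrow> (Succ (Var a) \<^bold>= Succ (Var b)))"
| "ax (Plus (Var a) Zero \<^bold>= Var a)"
| "ax (Plus (Var a) (Succ (Var b)) \<^bold>= Succ (Plus (Var a) (Var b)))"
| "ax (Times (Var a) Zero \<^bold>= Zero)"
| "ax (Times (Var a) (Succ (Var b)) \<^bold>= Plus (Times (Var a) (Var b)) (Var a))"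
| "ax ((subst x Zero F \<^bold>\<and> All x (F \<^bold>\<Rightarrow> subst x (Succ (Var x)) F)) \<^bold>\<Rightarrow> All x F)"

text \<open>The quantifier schemata \<open>(B \<Rightarrow> A) \<Rightarrow> (B \<Rightarrow> \<forall>xA)\<close> and \<open>(A \<Rightarrow> B) \<Rightarrow> (\<exists>xA \<Rightarrow> B)\<close> are rules
  of inference. As axioms they would make the system inconsistent.\<close>

inductive follows :: "fm set \<Rightarrow> fm \<Rightarrow> bool" for \<Gamma> where
  "A \<in> \<Gamma> \<Longrightarrow> (A \<^bold>\<Rightarrow> B) \<in> \<Gamma> \<Longrightarrow> follows \<Gamma> B"
| "(C \<^bold>\<Rightarrow> F) \<in> \<Gamma> \<Longrightarrow> x \<notin> fv C \<Longrightarrow> follows \<Gamma> (C \<^bold>\<Rightarrow> All x F)"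
| "(F \<^bold>\<Rightarrow> C) \<in> \<Gamma> \<Longrightarrow> x \<notin> fv C \<Longrightarrow> follows \<Gamma> (Ex x F \<^bold>\<Rightarrow> C)"

definition is_proof_of :: "fm list \<Rightarrow> fm \<Rightarrow> bool" where
  "is_proof_of fs F \<longleftrightarrow> fs \<noteq> [] \<and> last fs = F \<and>
     (\<forall>i < length fs. ax (fs ! i) \<or> follows (set (take i fs)) (fs ! i))"

definition provable :: "fm \<Rightarrow> bool"  ("\<turnstile> _" [50] 50) where
  "\<turnstile> F \<longleftrightarrow> (\<exists>fs. is_proof_of fs F)"

definition S_consistent :: bool where
  "S_consistent \<longleftrightarrow> \<not> (\<exists>B. \<turnstile> B \<and> \<turnstile> Neg B)"


section \<open>Expressions and Goedel numbers\<close>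

datatype symb =
    SPrime | SZero | LParen | RParen | LBrace | RBrace | LBracket | RBracket
  | SPlus | STimes | SEq | SImp | SAnd | SOr | SNeg | SAll | SEx | SComma

type_synonym expr = "symb list"

primrec symb_num :: "symb \<Rightarrow> nat" where
  "symb_num SPrime = 2 ^ 0"
| "symb_num SZero = 2 ^ 1"
| "symb_num LParen = 2 ^ 2"
| "symb_num RParen = 2 ^ 3"
| "symb_num LBrace = 2 ^ 4"
| "symb_num RBrace = 2 ^ 5"
| "symb_num LBracket = 2 ^ 6"
| "symb_num RBracket = 2 ^ 7"
| "symb_num SPlus = 2 ^ 8"
| "symb_num STimes = 2 ^ 9"
| "symb_num SEq = 2 ^ 10"
| "symb_num SImp = 2 ^ 11"
| "symb_num SAnd = 2 ^ 12"
| "symb_num SOr = 2 ^ 13"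
| "symb_num SNeg = 2 ^ 14"
| "symb_num SAll = 2 ^ 15"
| "symb_num SEx = 2 ^ 16"
| "symb_num SComma = 2 ^ 17"

text \<open>\<^term>\<open>floorlog 2 m\<close> is the number of binary digits of \<open>m\<close>, and \<open>0\<close> for \<open>m = 0\<close>.\<close>

definition star :: "nat \<Rightarrow> nat \<Rightarrow> nat"  (infixr "\<star>" 70) where
  "n \<star> m = 2 ^ floorlog 2 m * n + m"

primrec gnum :: "expr \<Rightarrow> nat" where
  "gnum [] = 0"
| "gnum (s # e) = symb_num s \<star> gnum e"

text \<open>Hence a concatenation of arbitrary expressions receives \<open>n \<star> m\<close>.\<close>

lemma floorlog_star: "0 < n \<Longrightarrow> floorlog 2 (n \<star> m) = floorlog 2 n + floorlog 2 m"
proof -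
  assume n: "0 < n"
  let ?k = "floorlog 2 m"
  have m: "m < 2 ^ ?k"
    by (rule floorlog_leD) simp_all
  have n1: "n < 2 ^ floorlog 2 n"
    by (rule floorlog_leD) simp_all
  have n2: "2 ^ (floorlog 2 n - 1) \<le> n"
    using floorlog_bounds[OF n, of 2] by simp
  have p: "0 < floorlog 2 n"
    using n by (simp add: floorlog_def)
  have "2 ^ (floorlog 2 n + ?k - 1) = 2 ^ ?k * (2::nat) ^ (floorlog 2 n - 1)"
    using p by (simp flip: power_add)
  also have "\<dots> \<le> 2 ^ ?k * n" using n2 by simp
  finally have lo: "2 ^ (floorlog 2 n + ?k - 1) \<le> n \<star> m"
    by (simp add: star_def)
  have "n \<star> m < 2 ^ ?k * (n + 1)" using m by (simp add: star_def algebra_simps)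
  also have "\<dots> \<le> 2 ^ ?k * 2 ^ floorlog 2 n" using n1 by (intro mult_left_mono) auto
  finally have hi: "n \<star> m < 2 ^ (floorlog 2 n + ?k)"
    by (simp add: power_add mult.commute)
  show ?thesis
  proof (rule antisym)
    show "floorlog 2 (n \<star> m) \<le> floorlog 2 n + ?k"
      by (rule floorlog_leI) (use hi in auto)
    show "floorlog 2 n + ?k \<le> floorlog 2 (n \<star> m)"
      using floorlog_geI[of 2 "floorlog 2 n + ?k" "n \<star> m"] lo p by simp
  qed
qed

lemma star_assoc: "(n \<star> m) \<star> k = n \<star> (m \<star> k)"
proof (cases "m = 0")
  case True
  then show ?thesis by (simp add: star_def floorlog_def)
next
  case False
  then have "floorlog 2 (m \<star> k) = floorlog 2 m + floorlog 2 k"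
    by (simp add: floorlog_star)
  then show ?thesis
    by (simp add: star_def power_add algebra_simps)
qed

lemma gnum_append: "gnum (e @ f) = gnum e \<star> gnum f"
  by (induction e) (simp_all add: star_assoc, simp add: star_def)

definition paren :: "expr \<Rightarrow> expr" where
  "paren e = [LParen] @ e @ [RParen]"

text \<open>The variables are \<open>(0')\<close>, \<open>(0'')\<close>, \<open>(0''')\<close>, ...; the one with index \<open>x\<close> has \<open>x + 1\<close> primes,
  since indices start at \<open>0\<close>.\<close>

definition var_expr :: "var \<Rightarrow> expr" where
  "var_expr x = paren ([SZero] @ replicate (x + 1) SPrime)"

primrec tm_expr :: "tm \<Rightarrow> expr" where
  "tm_expr Zero = [SZero]"
| "tm_expr (Var x) = var_expr x"
| "tm_expr (Succ s) = paren (tm_expr s) @ [SPrime]"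
| "tm_expr (Plus s t) = paren (tm_expr s) @ [SPlus] @ paren (tm_expr t)"
| "tm_expr (Times s t) = paren (tm_expr s) @ [STimes] @ paren (tm_expr t)"

primrec fm_expr :: "fm \<Rightarrow> expr" where
  "fm_expr (s \<^bold>= t) = paren (tm_expr s) @ [SEq] @ paren (tm_expr t)"
| "fm_expr (A \<^bold>\<Rightarrow> B) = paren (fm_expr A) @ [SImp] @ paren (fm_expr B)"
| "fm_expr (A \<^bold>\<and> B) = paren (fm_expr A) @ [SAnd] @ paren (fm_expr B)"
| "fm_expr (A \<^bold>\<or> B) = paren (fm_expr A) @ [SOr] @ paren (fm_expr B)"
| "fm_expr (Neg A) = [SNeg] @ paren (fm_expr A)"
| "fm_expr (All x A) = [SAll] @ var_expr x @ paren (fm_expr A)"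
| "fm_expr (Ex x A) = [SEx] @ var_expr x @ paren (fm_expr A)"

fun proof_expr :: "fm list \<Rightarrow> expr" where
  "proof_expr [] = []"
| "proof_expr [A] = fm_expr A"
| "proof_expr (A # B # fs) = fm_expr A @ [SComma] @ proof_expr (B # fs)"


section \<open>Numerals and the predicates G and H\<close>

definition numeral_tm :: "nat \<Rightarrow> tm"  ("\<lceil>_\<rceil>\<^sub>S") where
  "\<lceil>n\<rceil>\<^sub>S = (Succ ^^ n) Zero"

text \<open>\<open>num_inst F x n\<close> is \<open>F(\<lceil>n\<rceil>)\<close>, with \<open>x\<close> the variable replaced; by convention this is not
  a literal replacement.\<close>

definition num_inst :: "fm \<Rightarrow> var \<Rightarrow> nat \<Rightarrow> fm" where
  "num_inst F x n = All x ((Var x \<^bold>= \<lceil>n\<rceil>\<^sub>S) \<^bold>\<Rightarrow> F)"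

definition G_pred :: "nat \<Rightarrow> nat \<Rightarrow> bool" where
  "G_pred a b \<longleftrightarrow> (\<exists>A x fs. gnum (fm_expr A) = a \<and> fv A = {x} \<and>
     gnum (proof_expr fs) = b \<and> is_proof_of fs (num_inst A x a))"

definition H_pred :: "nat \<Rightarrow> nat \<Rightarrow> bool" where
  "H_pred a b \<longleftrightarrow> (\<exists>A x fs. gnum (fm_expr A) = a \<and> fv A = {x} \<and>
     gnum (proof_expr fs) = b \<and> is_proof_of fs (Neg (num_inst A x a)))"

definition numeralwise_expresses :: "fm \<Rightarrow> var \<Rightarrow> var \<Rightarrow> (nat \<Rightarrow> nat \<Rightarrow> bool) \<Rightarrow> bool" where
  "numeralwise_expresses F x y P \<longleftrightarrow>
     (\<forall>m n. (P m n \<longrightarrow> \<turnstile> num_inst (num_inst F x m) y n) \<and>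
            (\<not> P m n \<longrightarrow> \<turnstile> Neg (num_inst (num_inst F x m) y n)))"


section \<open>The Rosser formula\<close>

definition va :: var where "va = 0"
definition vb :: var where "vb = 1"
definition vc :: var where "vc = 2"

text \<open>\<open>s \<le> t\<close>, with the bound variable \<open>x\<close> made explicit; \<open>x\<close> must not occur in \<open>s\<close> or \<open>t\<close>.\<close>

definition leq_fm :: "var \<Rightarrow> tm \<Rightarrow> tm \<Rightarrow> fm" where
  "leq_fm x s t = Ex x (Plus s (Var x) \<^bold>= t)"

primrec all_vars :: "fm \<Rightarrow> var set" where
  "all_vars (s \<^bold>= t) = tvars s \<union> tvars t"
| "all_vars (A \<^bold>\<Rightarrow> B) = all_vars A \<union> all_vars B"
| "all_vars (A \<^bold>\<and> B) = all_vars A \<union> all_vars B"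
| "all_vars (A \<^bold>\<or> B) = all_vars A \<union> all_vars B"
| "all_vars (Neg A) = all_vars A"
| "all_vars (All y A) = insert y (all_vars A)"
| "all_vars (Ex y A) = insert y (all_vars A)"

text \<open>\<open>rename_bound y z F\<close> renames the bound occurrences of \<open>y\<close> in \<open>F\<close> to \<open>z\<close>, for a
  variable \<open>z\<close> not occurring in \<open>F\<close>.\<close>

primrec rename_bound :: "var \<Rightarrow> var \<Rightarrow> fm \<Rightarrow> fm" where
  "rename_bound y z (s \<^bold>= t) = (s \<^bold>= t)"
| "rename_bound y z (A \<^bold>\<Rightarrow> B) = (rename_bound y z A \<^bold>\<Rightarrow> rename_bound y z B)"
| "rename_bound y z (A \<^bold>\<and> B) = (rename_bound y z A \<^bold>\<and> rename_bound y z B)"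
| "rename_bound y z (A \<^bold>\<or> B) = (rename_bound y z A \<^bold>\<or> rename_bound y z B)"
| "rename_bound y z (Neg A) = Neg (rename_bound y z A)"
| "rename_bound y z (All w A) =
     (if w = y then All z (subst y (Var z) (rename_bound y z A)) else All w (rename_bound y z A))"
| "rename_bound y z (Ex w A) =
     (if w = y then Ex z (subst y (Var z) (rename_bound y z A)) else Ex w (rename_bound y z A))"

text \<open>\<open>var_inst F x y\<close> is \<open>F(y)\<close> for a formula \<open>F(x)\<close> and a variable \<open>y\<close>: the literal replacement
  of \<open>x\<close> by \<open>y\<close> if \<open>y\<close> is free for \<open>x\<close> in \<open>F\<close>; otherwise the bound occurrences of \<open>y\<close> are first
  renamed to a fresh variable.\<close>

definition var_inst :: "fm \<Rightarrow> var \<Rightarrow> var \<Rightarrow> fm" where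
  "var_inst F x y =
     (if free_for (Var y) x F then subst x (Var y) F
      else subst x (Var y) (rename_bound y (LEAST z. z \<notin> all_vars F \<union> {x, y}) F))"

text \<open>\<open>A\<^sub>q(a)\<close>, for given formulae \<open>g(a,b)\<close>, \<open>h(a,b)\<close> and bound variable \<open>x\<close> of \<open>c \<le> b\<close>.\<close>

definition rosser_fm :: "fm \<Rightarrow> fm \<Rightarrow> var \<Rightarrow> fm" where
  "rosser_fm g h x = All vb (g \<^bold>\<Rightarrow> Ex vc (leq_fm x (Var vc) (Var vb) \<^bold>\<and> var_inst h vb vc))"

text \<open>The displayed form of \<open>A\<^sub>q(\<lceil>q\<rceil>)\<close>, with \<open>\<lceil>q\<rceil>\<close> put into \<open>g\<close> and \<open>h\<close> separately. As a string of
  symbols it differs from \<^term>\<open>num_inst (rosser_fm g h x) va q\<close>, the formula \<open>A\<^sub>q(\<lceil>q\<rceil>)\<close> that the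
  predicates G and H refer to.\<close>

definition rosser_sentence :: "fm \<Rightarrow> fm \<Rightarrow> var \<Rightarrow> nat \<Rightarrow> fm" where
  "rosser_sentence g h x q =
     All vb (num_inst g va q \<^bold>\<Rightarrow>
       Ex vc (leq_fm x (Var vc) (Var vb) \<^bold>\<and> num_inst (var_inst h vb vc) va q))"

end

theory Submission
  imports Defs
begin

text \<open>Rosser's argument. If \<open>A\<^sub>q(\<lceil>q\<rceil>)\<close> has a proof with number \<open>n\<close>, then \<open>g(\<lceil>q\<rceil>,\<lceil>n\<rceil>)\<close> is provable, so
  \<open>\<exists>c (c \<le> \<lceil>n\<rceil> \<and> h(\<lceil>q\<rceil>,c))\<close> is; but by consistency every \<open>\<not> h(\<lceil>q\<rceil>,\<lceil>k\<rceil>)\<close> is provable, and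
  \<open>c \<le> \<lceil>n\<rceil>\<close> reduces provably to the cases \<open>c = \<lceil>k\<rceil>\<close> with \<open>k \<le> n\<close>. If \<open>\<not> A\<^sub>q(\<lceil>q\<rceil>)\<close> has a proof
  with number \<open>n\<close>, then \<open>h(\<lceil>q\<rceil>,\<lceil>n\<rceil>)\<close> and every \<open>\<not> g(\<lceil>q\<rceil>,\<lceil>k\<rceil>)\<close> are provable; provably, \<open>b\<close> is
  one of the \<open>\<lceil>k\<rceil>\<close> with \<open>k < n\<close>, which refutes \<open>g(\<lceil>q\<rceil>,b)\<close>, or \<open>\<lceil>n\<rceil> \<le> b\<close>, which makes \<open>c = \<lceil>n\<rceil>\<close> a
  witness, so \<open>A\<^sub>q(\<lceil>q\<rceil>)\<close> is provable as well. Injectivity of the Goedel numbering of formulae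
  identifies the formula that the predicates G and H speak about. Substitution of numerals, of
  variables and renaming of bound variables are all reduced to Leibniz's law for \<open>=\<close> in S.\<close>

section \<open>Formal proofs as lists that can be concatenated\<close>

section \<open>Provability and propositional valuations\<close>

text \<open>Drops the demand on the last formula from \<open>is_proof_of\<close>, so that
  concatenation preserves it. Truncating after any member recovers a proof of that member.\<close>

definition pf :: "fm list \<Rightarrow> bool" where
  "pf fs \<longleftrightarrow> (\<forall>i < length fs. ax (fs ! i) \<or> follows (set (take i fs)) (fs ! i))"

lemma follows_mono: "follows \<Gamma> F \<Longrightarrow> \<Gamma> \<subseteq> \<Delta> \<Longrightarrow> follows \<Delta> F"
  by (induction rule: follows.induct) (auto intro: follows.intros)

lemma pf_append: "pf fs \<Longrightarrow> pf gs \<Longrightarrow> pf (fs @ gs)"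
  unfolding pf_def
proof (intro allI impI)
  fix i
  assume fs: "\<forall>i < length fs. ax (fs ! i) \<or> follows (set (take i fs)) (fs ! i)"
    and gs: "\<forall>i < length gs. ax (gs ! i) \<or> follows (set (take i gs)) (gs ! i)"
    and i: "i < length (fs @ gs)"
  show "ax ((fs @ gs) ! i) \<or> follows (set (take i (fs @ gs))) ((fs @ gs) ! i)"
  proof (cases "i < length fs")
    case True
    then show ?thesis using fs by (auto simp: nth_append)
  next
    case False
    then have "ax (gs ! (i - length fs)) \<or>
        follows (set (take (i - length fs) gs)) (gs ! (i - length fs))"
      using gs i by auto
    then show ?thesis
      using False by (auto simp: nth_append intro: follows_mono)
  qed
qed

lemma pf_snoc: "pf fs \<Longrightarrow> ax F \<or> follows (set fs) F \<Longrightarrow> pf (fs @ [F])"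
  by (auto simp: pf_def nth_append less_Suc_eq)

lemma provable_iff_pf: "\<turnstile> F \<longleftrightarrow> (\<exists>fs. pf fs \<and> F \<in> set fs)"
proof
  assume "\<turnstile> F"
  then show "\<exists>fs. pf fs \<and> F \<in> set fs"
    by (auto simp: provable_def is_proof_of_def pf_def)
next
  assume "\<exists>fs. pf fs \<and> F \<in> set fs"
  then obtain fs i where fs: "pf fs" and i: "i < length fs" "fs ! i = F"
    by (auto simp: in_set_conv_nth)
  have "is_proof_of (take (Suc i) fs) F"
    unfolding is_proof_of_def using fs i
    by (auto simp: pf_def take_Suc_conv_app_nth nth_append min_def less_Suc_eq)
  then show "\<turnstile> F"
    by (auto simp: provable_def)
qed

lemma provable_ax: "ax F \<Longrightarrow> \<turnstile> F"
  unfolding provable_iff_pf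
  by (rule exI[of _ "[F]"]) (simp add: pf_def)

lemma provable_mp: "\<turnstile> A \<Longrightarrow> \<turnstile> A \<^bold>\<Rightarrow> B \<Longrightarrow> \<turnstile> B"
proof -
  assume "\<turnstile> A" "\<turnstile> A \<^bold>\<Rightarrow> B"
  then obtain fs gs where "pf fs" "A \<in> set fs" "pf gs" "(A \<^bold>\<Rightarrow> B) \<in> set gs"
    by (auto simp: provable_iff_pf)
  then have "pf ((fs @ gs) @ [B])"
    by (intro pf_snoc pf_append disjI2 follows.intros(1)[of A]) auto
  then show "\<turnstile> B"
    unfolding provable_iff_pf by (rule exI[of _ "(fs @ gs) @ [B]", OF conjI]) simp
qed

lemma imp_allI: "\<turnstile> C \<^bold>\<Rightarrow> F \<Longrightarrow> x \<notin> fv C \<Longrightarrow> \<turnstile> C \<^bold>\<Rightarrow> All x F"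
proof -
  assume "\<turnstile> C \<^bold>\<Rightarrow> F" and x: "x \<notin> fv C"
  then obtain fs where "pf fs" "(C \<^bold>\<Rightarrow> F) \<in> set fs"
    by (auto simp: provable_iff_pf)
  then have "pf (fs @ [C \<^bold>\<Rightarrow> All x F])"
    using x by (intro pf_snoc disjI2 follows.intros(2))
  then show ?thesis
    unfolding provable_iff_pf by (rule exI[of _ "fs @ [C \<^bold>\<Rightarrow> All x F]", OF conjI]) simp
qed

lemma ex_impI: "\<turnstile> F \<^bold>\<Rightarrow> C \<Longrightarrow> x \<notin> fv C \<Longrightarrow> \<turnstile> Ex x F \<^bold>\<Rightarrow> C"
proof -
  assume "\<turnstile> F \<^bold>\<Rightarrow> C" and x: "x \<notin> fv C"
  then obtain fs where "pf fs" "(F \<^bold>\<Rightarrow> C) \<in> set fs"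
    by (auto simp: provable_iff_pf)
  then have "pf (fs @ [Ex x F \<^bold>\<Rightarrow> C])"
    using x by (intro pf_snoc disjI2 follows.intros(3))
  then show ?thesis
    unfolding provable_iff_pf by (rule exI[of _ "fs @ [Ex x F \<^bold>\<Rightarrow> C]", OF conjI]) simp
qed

section \<open>Completeness of classical propositional reasoning over the provable formulae\<close>

definition val :: "(fm \<Rightarrow> bool) \<Rightarrow> bool" where
  "val v \<longleftrightarrow> (\<forall>F. \<turnstile> F \<longrightarrow> v F) \<and> (\<forall>A B. v (A \<^bold>\<Rightarrow> B) = (v A \<longrightarrow> v B)) \<and>
     (\<forall>A B. v (A \<^bold>\<and> B) = (v A \<and> v B)) \<and> (\<forall>A B. v (A \<^bold>\<or> B) = (v A \<or> v B)) \<and>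
     (\<forall>A. v (Neg A) = (\<not> v A))"

lemma val_simps:
  assumes "val v"
  shows "v (A \<^bold>\<Rightarrow> B) = (v A \<longrightarrow> v B)" "v (A \<^bold>\<and> B) = (v A \<and> v B)"
    "v (A \<^bold>\<or> B) = (v A \<or> v B)" "v (Neg A) = (\<not> v A)"
  using assms by (simp_all add: val_def)

lemma val_provable: "val v \<Longrightarrow> \<turnstile> F \<Longrightarrow> v F"
  by (simp add: val_def)

text \<open>Theories here are closed under modus ponens alone, not under the quantifier rules. This
  gives the deduction theorem \<open>mp_closed_imp\<close> without conditions on variables.\<close>

definition mp_closed :: "fm set \<Rightarrow> bool" where
  "mp_closed T \<longleftrightarrow> (\<forall>A. \<turnstile> A \<longrightarrow> A \<in> T) \<and> (\<forall>A B. A \<in> T \<longrightarrow> (A \<^bold>\<Rightarrow> B) \<in> T \<longrightarrow> B \<in> T)"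

lemma mp_closed_ax: "mp_closed T \<Longrightarrow> ax F \<Longrightarrow> F \<in> T"
  by (simp add: mp_closed_def provable_ax)

lemma mp_closedD: "mp_closed T \<Longrightarrow> (A \<^bold>\<Rightarrow> B) \<in> T \<Longrightarrow> A \<in> T \<Longrightarrow> B \<in> T"
  unfolding mp_closed_def by blast

lemma mp_closed_K: "mp_closed T \<Longrightarrow> B \<in> T \<Longrightarrow> (A \<^bold>\<Rightarrow> B) \<in> T"
  by (rule mp_closedD[OF _ mp_closed_ax[OF _ ax.intros(1)]])

lemma mp_closed_refl:
  assumes T: "mp_closed T"
  shows "(A \<^bold>\<Rightarrow> A) \<in> T"
proof -
  have "(A \<^bold>\<Rightarrow> A \<^bold>\<Rightarrow> A) \<in> T" "(A \<^bold>\<Rightarrow> (A \<^bold>\<Rightarrow> A) \<^bold>\<Rightarrow> A) \<in> T"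
    by (rule mp_closed_ax[OF T ax.intros(1)])+
  then show ?thesis
    using mp_closedD[OF T] mp_closed_ax[OF T ax.intros(2), of A "A \<^bold>\<Rightarrow> A" A] by blast
qed

text \<open>Deduction theorem: the set on the right is the theory generated by \<open>T\<close> and
  \<open>A\<close>. Its closure under modus ponens is the second propositional axiom.\<close>

lemma mp_closed_imp: "mp_closed T \<Longrightarrow> mp_closed {B. (A \<^bold>\<Rightarrow> B) \<in> T}"
proof -
  assume T: "mp_closed T"
  then have "(A \<^bold>\<Rightarrow> C) \<in> T" if "(A \<^bold>\<Rightarrow> B) \<in> T" "(A \<^bold>\<Rightarrow> B \<^bold>\<Rightarrow> C) \<in> T" for B C
    using that by (meson ax.intros(2) mp_closed_ax mp_closedD)
  moreover have "(A \<^bold>\<Rightarrow> B) \<in> T" if "\<turnstile> B" for B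
  proof (rule mp_closed_K[OF T])
    show "B \<in> T" using T that by (simp add: mp_closed_def)
  qed
  ultimately show ?thesis
    unfolding mp_closed_def by blast
qed

text \<open>Both \<open>A\<close> and \<open>Neg A\<close> follow from \<open>Neg B\<close>, so
  reductio yields \<open>Neg (Neg B)\<close>.\<close>

lemma mp_closed_explode:
  assumes T: "mp_closed T" and "A \<in> T" "Neg A \<in> T"
  shows "B \<in> T"
proof -
  have "(Neg B \<^bold>\<Rightarrow> A) \<in> T" "(Neg B \<^bold>\<Rightarrow> Neg A) \<in> T"
    using assms by (auto intro: mp_closed_K)
  then have "Neg (Neg B) \<in> T"
    using mp_closedD[OF T] mp_closed_ax[OF T ax.intros(10), of "Neg B" A] by blast
  then show ?thesis
    using mp_closedD[OF T] mp_closed_ax[OF T ax.intros(11), of B] by blast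
qed

text \<open>Lindenbaum's construction: Zorn's lemma gives a theory \<open>M\<close> maximal among
  those omitting \<open>F\<close>, and membership in \<open>M\<close> is the valuation. Equations
  and quantified formulae act as propositional atoms, constrained only by the truth of all provable
  formulae.\<close>

lemma exists_val:
  assumes F: "\<not> (\<turnstile> F)"
  shows "\<exists>v. val v \<and> \<not> v F"
proof -
  let ?\<A> = "{T. mp_closed T \<and> F \<notin> T}"
  have "\<exists>M\<in>?\<A>. \<forall>X\<in>?\<A>. M \<subseteq> X \<longrightarrow> X = M"
  proof (rule subset_Zorn_nonempty)
    have "{A. \<turnstile> A} \<in> ?\<A>"
      using F by (auto simp: mp_closed_def intro: provable_mp)
    then show "?\<A> \<noteq> {}" by blast
  next
    fix \<C> assume ne: "\<C> \<noteq> {}" and ch: "subset.chain ?\<A> \<C>"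
    have closed: "mp_closed T" and notin: "F \<notin> T" if "T \<in> \<C>" for T
      using ch that by (auto simp: subset_chain_def)
    have "\<exists>T\<in>\<C>. A \<in> T \<and> (A \<^bold>\<Rightarrow> B) \<in> T" if AB: "A \<in> \<Union>\<C>" "(A \<^bold>\<Rightarrow> B) \<in> \<Union>\<C>" for A B
    proof -
      obtain T U where TU: "T \<in> \<C>" "A \<in> T" "U \<in> \<C>" "(A \<^bold>\<Rightarrow> B) \<in> U"
        using AB by blast
      then have "T \<subseteq> U \<or> U \<subseteq> T"
        using ch by (auto simp: subset_chain_def)
      with TU show ?thesis by blast
    qed
    then have "B \<in> \<Union>\<C>" if "A \<in> \<Union>\<C>" "(A \<^bold>\<Rightarrow> B) \<in> \<Union>\<C>" for A B
      using that closed mp_closedD by blast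
    moreover have "A \<in> \<Union>\<C>" if "\<turnstile> A" for A
      using ne closed that by (auto simp: mp_closed_def)
    ultimately show "\<Union>\<C> \<in> ?\<A>"
      using notin unfolding mp_closed_def by blast
  qed
  then obtain M where M: "mp_closed M" and FM: "F \<notin> M"
    and max: "\<And>X. mp_closed X \<Longrightarrow> F \<notin> X \<Longrightarrow> M \<subseteq> X \<Longrightarrow> X = M"
    by blast
  \<comment> \<open>The theory generated by \<open>M\<close> and \<open>A\<close> would omit
    \<open>F\<close>, hence equal \<open>M\<close> by maximality; but it contains
    \<open>A\<close>.\<close>
  have imp_F: "(A \<^bold>\<Rightarrow> F) \<in> M" if "A \<notin> M" for A
  proof (rule ccontr)
    assume "(A \<^bold>\<Rightarrow> F) \<notin> M"
    then have "{B. (A \<^bold>\<Rightarrow> B) \<in> M} = M"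
      using M by (intro max mp_closed_imp) (auto intro: mp_closed_K)
    with M that show False
      using mp_closed_refl by blast
  qed
  \<comment> \<open>If \<open>Neg F\<close> were missing, \<open>imp_F\<close> would make it imply
    \<open>F\<close>, and reductio with double negation would put \<open>F\<close> into
    \<open>M\<close>.\<close>
  have negF: "Neg F \<in> M"
    by (meson FM M ax.intros(10,11) imp_F mp_closed_ax mp_closedD mp_closed_refl)
  have neg: "Neg A \<in> M \<longleftrightarrow> A \<notin> M" for A
  proof
    assume "Neg A \<in> M"
    with FM M show "A \<notin> M" using mp_closed_explode by blast
  next
    assume "A \<notin> M"
    then have "(A \<^bold>\<Rightarrow> F) \<in> M" "(A \<^bold>\<Rightarrow> Neg F) \<in> M"
      using M negF by (auto intro: imp_F mp_closed_K)
    then show "Neg A \<in> M"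
      using M by (meson ax.intros(10) mp_closed_ax mp_closedD)
  qed
  have imp: "(A \<^bold>\<Rightarrow> B) \<in> M \<longleftrightarrow> (A \<in> M \<longrightarrow> B \<in> M)" for A B
  proof
    assume "(A \<^bold>\<Rightarrow> B) \<in> M"
    with M show "A \<in> M \<longrightarrow> B \<in> M" using mp_closedD by blast
  next
    assume *: "A \<in> M \<longrightarrow> B \<in> M"
    show "(A \<^bold>\<Rightarrow> B) \<in> M"
    proof (cases "A \<in> M")
      case True
      with * M show ?thesis by (auto intro: mp_closed_K)
    next
      case False
      \<comment> \<open>This theory contains \<open>A\<close>, and also \<open>Neg A\<close> because
        \<open>A\<close> is missing from \<open>M\<close>; so it contains every formula.\<close>
      let ?T = "{X. (A \<^bold>\<Rightarrow> X) \<in> M}"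
      have "B \<in> ?T"
        by (rule mp_closed_explode[of _ A])
          (use M False neg in \<open>auto intro: mp_closed_imp mp_closed_refl mp_closed_K\<close>)
      then show ?thesis by simp
    qed
  qed
  have conj: "(A \<^bold>\<and> B) \<in> M \<longleftrightarrow> A \<in> M \<and> B \<in> M" for A B
    by (meson M ax.intros(4,5,6) mp_closed_ax mp_closedD)
  have disj: "(A \<^bold>\<or> B) \<in> M \<longleftrightarrow> A \<in> M \<or> B \<in> M" for A B
    by (meson M FM imp_F ax.intros(7,8,9) mp_closed_ax mp_closedD)
  have "val (\<lambda>A. A \<in> M)"
    using M neg imp conj disj by (auto simp: val_def mp_closed_def)
  with FM show ?thesis by blast
qed

text \<open>A derivation from provable formulae that uses only propositional logic thus becomes an argument
  about a single valuation in the metalogic.\<close>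

lemma provableI: "(\<And>v. val v \<Longrightarrow> v F) \<Longrightarrow> \<turnstile> F"
  using exists_val by blast

lemma provableI1:
  assumes "\<turnstile> A" and "\<And>v. val v \<Longrightarrow> v A \<Longrightarrow> v B"
  shows "\<turnstile> B"
  by (rule provableI) (use assms val_provable in blast)

lemma provableI2:
  assumes "\<turnstile> A" "\<turnstile> B" and "\<And>v. val v \<Longrightarrow> v A \<Longrightarrow> v B \<Longrightarrow> v C"
  shows "\<turnstile> C"
  by (rule provableI) (use assms val_provable in blast)

text \<open>With the hypotheses inside the formula the simplifier does not use them as rewrite rules,
  which would loop on equivalences.\<close>

lemma taut1: "\<turnstile> A \<Longrightarrow> (\<And>v. val v \<Longrightarrow> v (A \<^bold>\<Rightarrow> B)) \<Longrightarrow> \<turnstile> B"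
  by (rule provable_mp[OF _ provableI])

lemma taut2: "\<turnstile> A \<Longrightarrow> \<turnstile> B \<Longrightarrow> (\<And>v. val v \<Longrightarrow> v (A \<^bold>\<Rightarrow> B \<^bold>\<Rightarrow> C)) \<Longrightarrow> \<turnstile> C"
  by (rule provable_mp[OF _ provable_mp[OF _ provableI]])

section \<open>Substitution and derived quantifier rules\<close>

section \<open>Quantifiers\<close>

lemma tsubst_fresh [simp]: "x \<notin> tvars s \<Longrightarrow> tsubst x t s = s"
  by (induction s) auto

lemma subst_fresh [simp]: "x \<notin> fv F \<Longrightarrow> subst x t F = F"
  by (induction F) auto

lemma tsubst_self [simp]: "tsubst x (Var x) s = s"
  by (induction s) auto

lemma subst_self [simp]: "subst x (Var x) F = F"
  by (induction F) auto

lemma free_for_self [simp]: "free_for (Var x) x F"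
  by (induction F) auto

lemma free_for_closed [simp]: "tvars t = {} \<Longrightarrow> free_for t x F"
  by (induction F) auto

lemma tvars_tsubstD: "y \<in> tvars (tsubst x t s) \<Longrightarrow> y \<in> tvars s \<and> y \<noteq> x \<or> y \<in> tvars t"
  by (induction s) (auto split: if_splits)

lemma fv_substD: "y \<in> fv (subst x t F) \<Longrightarrow> y \<in> fv F \<and> y \<noteq> x \<or> y \<in> tvars t"
  by (induction F) (auto split: if_splits dest: tvars_tsubstD)

lemma all_elim: "\<turnstile> All x F \<^bold>\<Rightarrow> F"
  using provable_ax[OF ax.intros(12)[of "Var x" x F]] by simp

lemma ex_intro: "\<turnstile> F \<^bold>\<Rightarrow> Ex x F"
  using provable_ax[OF ax.intros(13)[of "Var x" x F]] by simp

lemma generalize: "\<turnstile> F \<Longrightarrow> \<turnstile> All x F"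
proof -
  assume F: "\<turnstile> F"
  \<comment> \<open>The quantifier rule acts on implications; a closed tautology serves as
    antecedent, so that \<open>x\<close> is unrestricted.\<close>
  let ?C = "(Zero \<^bold>= Zero) \<^bold>\<Rightarrow> (Zero \<^bold>= Zero)"
  have "\<turnstile> ?C \<^bold>\<Rightarrow> All x F"
    by (intro imp_allI provableI1[OF F]) (auto simp: val_simps)
  then show ?thesis
    by (rule taut1) (simp only: val_simps; blast)
qed

lemma provable_subst: "\<turnstile> F \<Longrightarrow> free_for t x F \<Longrightarrow> \<turnstile> subst x t F"
  by (rule provable_mp[OF generalize provable_ax[OF ax.intros(12)]])

text \<open>The rule admits one antecedent, so \<open>C\<close> and \<open>All x A\<close> are
  joined to a conjunction in which \<open>x\<close> is not free.\<close>

lemma imp_all_mono: "\<turnstile> C \<^bold>\<Rightarrow> A \<^bold>\<Rightarrow> B \<Longrightarrow> x \<notin> fv C \<Longrightarrow> \<turnstile> C \<^bold>\<Rightarrow> All x A \<^bold>\<Rightarrow> All x B"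
proof -
  assume AB: "\<turnstile> C \<^bold>\<Rightarrow> A \<^bold>\<Rightarrow> B" and x: "x \<notin> fv C"
  have "\<turnstile> (C \<^bold>\<and> All x A) \<^bold>\<Rightarrow> All x B"
    using x by (intro imp_allI provableI2[OF AB all_elim[of x A]]) (auto simp: val_simps)
  then show ?thesis
    by (rule taut1) (simp only: val_simps; blast)
qed

text \<open>The existential formula must stand alone on the left for the rule to apply, so
  \<open>C\<close> is moved into the conclusion.\<close>

lemma imp_ex_mono: "\<turnstile> C \<^bold>\<Rightarrow> A \<^bold>\<Rightarrow> B \<Longrightarrow> x \<notin> fv C \<Longrightarrow> \<turnstile> C \<^bold>\<Rightarrow> Ex x A \<^bold>\<Rightarrow> Ex x B"
proof -
  assume AB: "\<turnstile> C \<^bold>\<Rightarrow> A \<^bold>\<Rightarrow> B" and x: "x \<notin> fv C"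
  have "\<turnstile> Ex x A \<^bold>\<Rightarrow> (C \<^bold>\<Rightarrow> Ex x B)"
    using x by (intro ex_impI provableI2[OF AB ex_intro[of B x]]) (auto simp: val_simps)
  then show ?thesis
    by (rule taut1) (simp only: val_simps; blast)
qed

abbreviation Iff :: "fm \<Rightarrow> fm \<Rightarrow> fm" where
  "Iff A B \<equiv> (A \<^bold>\<Rightarrow> B) \<^bold>\<and> (B \<^bold>\<Rightarrow> A)"

text \<open>The side formula \<open>C\<close> is the equation in the quantifier cases of Leibniz's
  law.\<close>

lemma imp_Iff_all: "\<turnstile> C \<^bold>\<Rightarrow> Iff A B \<Longrightarrow> x \<notin> fv C \<Longrightarrow> \<turnstile> C \<^bold>\<Rightarrow> Iff (All x A) (All x B)"
  and imp_Iff_ex: "\<turnstile> C \<^bold>\<Rightarrow> Iff A B \<Longrightarrow> x \<notin> fv C \<Longrightarrow> \<turnstile> C \<^bold>\<Rightarrow> Iff (Ex x A) (Ex x B)"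
proof -
  assume AB: "\<turnstile> C \<^bold>\<Rightarrow> Iff A B" and x: "x \<notin> fv C"
  have 1: "\<turnstile> C \<^bold>\<Rightarrow> A \<^bold>\<Rightarrow> B" and 2: "\<turnstile> C \<^bold>\<Rightarrow> B \<^bold>\<Rightarrow> A"
    by (rule provableI1[OF AB]; auto simp: val_simps)+
  show "\<turnstile> C \<^bold>\<Rightarrow> Iff (All x A) (All x B)"
    by (rule taut2[OF imp_all_mono[OF 1 x] imp_all_mono[OF 2 x]]) (simp only: val_simps; blast)
  show "\<turnstile> C \<^bold>\<Rightarrow> Iff (Ex x A) (Ex x B)"
    by (rule taut2[OF imp_ex_mono[OF 1 x] imp_ex_mono[OF 2 x]]) (simp only: val_simps; blast)
qed

lemma Iff_all: "\<turnstile> Iff A B \<Longrightarrow> \<turnstile> Iff (All x A) (All x B)"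
  and Iff_ex: "\<turnstile> Iff A B \<Longrightarrow> \<turnstile> Iff (Ex x A) (Ex x B)"
proof -
  let ?C = "(Zero \<^bold>= Zero) \<^bold>\<Rightarrow> (Zero \<^bold>= Zero)"
  assume "\<turnstile> Iff A B"
  then have AB: "\<turnstile> ?C \<^bold>\<Rightarrow> Iff A B"
    by (rule taut1) (simp only: val_simps; blast)
  have x: "x \<notin> fv ?C" by simp
  show "\<turnstile> Iff (All x A) (All x B)"
    by (rule taut1[OF imp_Iff_all[OF AB x]]) (simp only: val_simps; blast)
  show "\<turnstile> Iff (Ex x A) (Ex x B)"
    by (rule taut1[OF imp_Iff_ex[OF AB x]]) (simp only: val_simps; blast)
qed

section \<open>The equality and successor axioms at arbitrary terms\<close>

section \<open>Equality and arithmetic in S\<close>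

lemma finite_tvars [simp]: "finite (tvars t)"
  by (induction t) auto

lemma fresh_var: "finite A \<Longrightarrow> \<exists>x::var. x \<notin> A"
  using ex_new_if_finite infinite_UNIV_nat by blast

lemma provable_eq_euclid: "\<turnstile> (s \<^bold>= t) \<^bold>\<Rightarrow> (s \<^bold>= u) \<^bold>\<Rightarrow> (t \<^bold>= u)"
proof -
  \<comment> \<open>The axiom speaks of variables only. They are replaced in the order
    \<open>a\<close>, \<open>b\<close>, \<open>c\<close>, and each is fresh for the terms inserted
    before it.\<close>
  obtain b where b: "b \<notin> tvars s" using fresh_var by force
  obtain c where c: "c \<notin> insert b (tvars s \<union> tvars t)" using fresh_var[of "insert b (tvars s \<union> tvars t)"] by auto
  obtain a where a: "a \<notin> {b, c}" using fresh_var[of "{b, c}"] by auto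
  have 1: "\<turnstile> (Var a \<^bold>= Var b) \<^bold>\<Rightarrow> (Var a \<^bold>= Var c) \<^bold>\<Rightarrow> (Var b \<^bold>= Var c)"
    by (intro provable_ax ax.intros)
  from provable_subst[OF 1, of s a] a
  have 2: "\<turnstile> (s \<^bold>= Var b) \<^bold>\<Rightarrow> (s \<^bold>= Var c) \<^bold>\<Rightarrow> (Var b \<^bold>= Var c)"
    by auto
  from provable_subst[OF 2, of t b] b c
  have 3: "\<turnstile> (s \<^bold>= t) \<^bold>\<Rightarrow> (s \<^bold>= Var c) \<^bold>\<Rightarrow> (t \<^bold>= Var c)"
    by auto
  from provable_subst[OF 3, of u c] c show ?thesis
    by auto
qed

text \<open>The conclusion lifts from two distinct variables to arbitrary terms, because the variables
  can be chosen fresh and then replaced one after the other.\<close>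

lemma lift_two:
  assumes "\<And>a b. a \<noteq> b \<Longrightarrow> a \<notin> X \<Longrightarrow> b \<notin> X \<Longrightarrow> \<turnstile> P (Var a) (Var b)" and "finite X"
    and "\<And>a b s. a \<noteq> b \<Longrightarrow> a \<notin> X \<Longrightarrow> b \<notin> X \<Longrightarrow>
      free_for s a (P (Var a) (Var b)) \<and> subst a s (P (Var a) (Var b)) = P s (Var b)"
    and "\<And>b s t. b \<notin> tvars s \<Longrightarrow> b \<notin> X \<Longrightarrow>
      free_for t b (P s (Var b)) \<and> subst b t (P s (Var b)) = P s t"
  shows "\<turnstile> P s t"
proof -
  obtain b where b: "b \<notin> tvars s \<union> X"
    using fresh_var[of "tvars s \<union> X"] assms(2) by auto
  obtain a where a: "a \<notin> insert b X"
    using fresh_var[of "insert b X"] assms(2) by auto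
  have "\<turnstile> P (Var a) (Var b)" using assms(1) a b by auto
  then have "\<turnstile> P s (Var b)"
    using provable_subst[of "P (Var a) (Var b)" s a] assms(3)[of a b s] a b by auto
  then show ?thesis
    using provable_subst[of "P s (Var b)" t b] assms(4)[of b s t] b by auto
qed

lemma provable_Succ_inject: "\<turnstile> (Succ s \<^bold>= Succ t) \<^bold>\<Rightarrow> (s \<^bold>= t)"
  by (rule lift_two[where X = "{}" and P = "\<lambda>s t. (Succ s \<^bold>= Succ t) \<^bold>\<Rightarrow> (s \<^bold>= t)"])
    (rule provable_ax, rule ax.intros, auto)

lemma provable_Succ_cong: "\<turnstile> (s \<^bold>= t) \<^bold>\<Rightarrow> (Succ s \<^bold>= Succ t)"
  by (rule lift_two[where X = "{}" and P = "\<lambda>s t. (s \<^bold>= t) \<^bold>\<Rightarrow> (Succ s \<^bold>= Succ t)"])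
    (rule provable_ax, rule ax.intros, auto)

lemma provable_plus_Succ: "\<turnstile> Plus s (Succ t) \<^bold>= Succ (Plus s t)"
  by (rule lift_two[where X = "{}" and P = "\<lambda>s t. Plus s (Succ t) \<^bold>= Succ (Plus s t)"])
    (rule provable_ax, rule ax.intros, auto)

lemma provable_times_Succ: "\<turnstile> Times s (Succ t) \<^bold>= Plus (Times s t) s"
  by (rule lift_two[where X = "{}" and P = "\<lambda>s t. Times s (Succ t) \<^bold>= Plus (Times s t) s"])
    (rule provable_ax, rule ax.intros, auto)

lemma provable_Succ_not_Zero: "\<turnstile> Neg (Succ s \<^bold>= Zero)"
  using provable_subst[OF provable_ax[OF ax.intros(15)], of s 0 0] by simp

lemma provable_plus_Zero: "\<turnstile> Plus s Zero \<^bold>= s"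
  using provable_subst[OF provable_ax[OF ax.intros(18)], of s 0 0] by simp

lemma provable_times_Zero: "\<turnstile> Times s Zero \<^bold>= Zero"
  using provable_subst[OF provable_ax[OF ax.intros(20)], of s 0 0] by simp

lemma val_eq_euclid: "val v \<Longrightarrow> v (s \<^bold>= t) \<Longrightarrow> v (s \<^bold>= u) \<Longrightarrow> v (t \<^bold>= u)"
  using val_provable[of v, OF _ provable_eq_euclid[of s t u]] by (simp add: val_simps)

text \<open>Reflexivity is not among the axioms: it results from using that
  \<open>Plus s Zero\<close> equals \<open>s\<close> for both premises of the Euclidean law.\<close>

lemma val_eq_refl: "val v \<Longrightarrow> v (s \<^bold>= s)"
  using val_eq_euclid[of v "Plus s Zero" s s] val_provable[of v, OF _ provable_plus_Zero[of s]]
  by blast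

lemma val_eq_sym: "val v \<Longrightarrow> v (s \<^bold>= t) \<Longrightarrow> v (t \<^bold>= s)"
  by (rule val_eq_euclid[OF _ _ val_eq_refl])

lemma val_eq_trans: "val v \<Longrightarrow> v (s \<^bold>= t) \<Longrightarrow> v (t \<^bold>= u) \<Longrightarrow> v (s \<^bold>= u)"
  by (rule val_eq_euclid[OF _ val_eq_sym])

lemma val_Succ: "val v \<Longrightarrow> v (Succ s \<^bold>= Succ t) \<longleftrightarrow> v (s \<^bold>= t)"
  using val_provable[of v, OF _ provable_Succ_cong[of s t]]
    val_provable[of v, OF _ provable_Succ_inject[of s t]]
  by (simp only: val_simps; blast)

lemma val_Succ_not_Zero: "val v \<Longrightarrow> \<not> v (Succ s \<^bold>= Zero)"
  and val_Zero_not_Succ: "val v \<Longrightarrow> \<not> v (Zero \<^bold>= Succ s)"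
  using val_provable[of v, OF _ provable_Succ_not_Zero[of s]] val_eq_sym[of v Zero "Succ s"]
  by (auto simp: val_simps)

section \<open>Induction and the congruence of sum and product\<close>

lemma provable_induct:
  assumes "\<turnstile> subst x Zero F" and "\<turnstile> F \<^bold>\<Rightarrow> subst x (Succ (Var x)) F"
  shows "\<turnstile> F"
proof -
  have "\<turnstile> subst x Zero F \<^bold>\<and> All x (F \<^bold>\<Rightarrow> subst x (Succ (Var x)) F)"
    by (rule provableI2[OF assms(1) generalize[OF assms(2)]]) (simp add: val_simps)
  then have "\<turnstile> All x F"
    by (rule provable_mp) (rule provable_ax, rule ax.intros(22))
  then show ?thesis
    by (rule provable_mp[OF _ all_elim])
qed

text \<open>Case distinction between zero and successor is induction with the induction hypothesis
  ignored.\<close>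

lemma provable_cases:
  assumes "\<turnstile> subst x Zero F" and "\<turnstile> subst x (Succ (Var x)) F"
  shows "\<turnstile> F"
  using assms(1) by (rule provable_induct) (rule provableI1[OF assms(2)], simp add: val_simps)

text \<open>Only successor is assumed to respect equality; for sum and product this needs induction.
  On the right argument, nested induction on both sides of the equation avoids commutativity.\<close>

lemma provable_right_cong:
  assumes Op: "\<And>x t r s. tsubst x t (Op r s) = Op (tsubst x t r) (tsubst x t s)"
    and Succ: "\<And>r s t. \<turnstile> (Op r s \<^bold>= Op r t) \<^bold>\<Rightarrow> (Op r (Succ s) \<^bold>= Op r (Succ t))"
  shows "\<turnstile> (s \<^bold>= t) \<^bold>\<Rightarrow> (Op r s \<^bold>= Op r t)"
proof (rule lift_two[where X = "tvars r" and P = "\<lambda>s t. (s \<^bold>= t) \<^bold>\<Rightarrow> (Op r s \<^bold>= Op r t)"])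
  fix a b assume ab: "a \<noteq> b" "a \<notin> tvars r" "b \<notin> tvars r"
  \<comment> \<open>The quantifier over \<open>b\<close> stays inside the induction on
    \<open>a\<close>: the successor step uses the hypothesis at the predecessor of \<open>b\<close>.
    When exactly one side is zero, the equation is refutable.\<close>
  let ?P = "\<lambda>a. All b ((a \<^bold>= Var b) \<^bold>\<Rightarrow> (Op r a \<^bold>= Op r (Var b)))"
  have "\<turnstile> (Zero \<^bold>= Zero) \<^bold>\<Rightarrow> (Op r Zero \<^bold>= Op r Zero)"
    and "\<turnstile> (Zero \<^bold>= Succ (Var b)) \<^bold>\<Rightarrow> (Op r Zero \<^bold>= Op r (Succ (Var b)))"
    by (rule provableI; simp add: val_simps val_eq_refl val_Zero_not_Succ)+
  then have "\<turnstile> (Zero \<^bold>= Var b) \<^bold>\<Rightarrow> (Op r Zero \<^bold>= Op r (Var b))"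
    using ab by - (rule provable_cases[of b], simp_all add: Op)
  then have 0: "\<turnstile> ?P Zero" by (rule generalize)
  have "\<turnstile> ?P (Var a) \<^bold>\<Rightarrow> (Succ (Var a) \<^bold>= Zero) \<^bold>\<Rightarrow> (Op r (Succ (Var a)) \<^bold>= Op r Zero)"
    by (rule provableI) (simp add: val_simps val_Succ_not_Zero)
  moreover have "\<turnstile> ?P (Var a) \<^bold>\<Rightarrow> (Succ (Var a) \<^bold>= Succ (Var b)) \<^bold>\<Rightarrow>
      (Op r (Succ (Var a)) \<^bold>= Op r (Succ (Var b)))"
    by (rule provableI2[OF Succ[of r "Var a" "Var b"] all_elim]) (auto simp: val_simps val_Succ)
  ultimately have "\<turnstile> ?P (Var a) \<^bold>\<Rightarrow> (Succ (Var a) \<^bold>= Var b) \<^bold>\<Rightarrow> (Op r (Succ (Var a)) \<^bold>= Op r (Var b))"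
    using ab by - (rule provable_cases[of b], simp_all add: Op)
  then have "\<turnstile> ?P (Var a) \<^bold>\<Rightarrow> ?P (Succ (Var a))"
    by (rule imp_allI) simp
  with 0 have "\<turnstile> ?P (Var a)"
    using ab by - (rule provable_induct[of a], simp_all add: Op)
  then show "\<turnstile> (Var a \<^bold>= Var b) \<^bold>\<Rightarrow> (Op r (Var a) \<^bold>= Op r (Var b))"
    by (rule provable_mp[OF _ all_elim])
qed (auto simp: Op)

text \<open>The recursion equations run along the right argument, so induction on that argument
  suffices, with \<open>s\<close> and \<open>t\<close> fixed. The induction variable is replaced by
  \<open>r\<close> at the end.\<close>

lemma provable_left_cong:
  assumes Op: "\<And>x t r s. tsubst x t (Op r s) = Op (tsubst x t r) (tsubst x t s)"
    and Zero: "\<And>s t. \<turnstile> (s \<^bold>= t) \<^bold>\<Rightarrow> (Op s Zero \<^bold>= Op t Zero)"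
    and Succ: "\<And>r s t. \<turnstile> (s \<^bold>= t) \<^bold>\<Rightarrow> (Op s r \<^bold>= Op t r) \<^bold>\<Rightarrow> (Op s (Succ r) \<^bold>= Op t (Succ r))"
  shows "\<turnstile> (s \<^bold>= t) \<^bold>\<Rightarrow> (Op s r \<^bold>= Op t r)"
proof -
  obtain c where c: "c \<notin> tvars s \<union> tvars t"
    using fresh_var[of "tvars s \<union> tvars t"] by auto
  have "\<turnstile> ((s \<^bold>= t) \<^bold>\<Rightarrow> (Op s (Var c) \<^bold>= Op t (Var c))) \<^bold>\<Rightarrow>
      (s \<^bold>= t) \<^bold>\<Rightarrow> (Op s (Succ (Var c)) \<^bold>= Op t (Succ (Var c)))"
    by (rule provableI1[OF Succ[of s t "Var c"]]) (simp add: val_simps)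
  then have "\<turnstile> (s \<^bold>= t) \<^bold>\<Rightarrow> (Op s (Var c) \<^bold>= Op t (Var c))"
    using c Zero[of s t] by - (rule provable_induct[of c], simp_all add: Op)
  from provable_subst[OF this, of r c] c show ?thesis
    by (simp add: Op)
qed

lemma val_plus_Zero: "val v \<Longrightarrow> v (Plus s Zero \<^bold>= s)"
  and val_plus_Succ: "val v \<Longrightarrow> v (Plus s (Succ t) \<^bold>= Succ (Plus s t))"
  and val_times_Zero: "val v \<Longrightarrow> v (Times s Zero \<^bold>= Zero)"
  and val_times_Succ: "val v \<Longrightarrow> v (Times s (Succ t) \<^bold>= Plus (Times s t) s)"
  by (rule val_provable, assumption, rule provable_plus_Zero provable_plus_Succ
      provable_times_Zero provable_times_Succ)+

text \<open>With recursion equations as premises it unfolds sums and products on either side of an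
  equation.\<close>

lemma val_eq_cong:
  assumes v: "val v" and "v (s \<^bold>= s')" "v (t \<^bold>= t')"
  shows "v (s \<^bold>= t) \<longleftrightarrow> v (s' \<^bold>= t')"
proof
  assume "v (s \<^bold>= t)"
  then show "v (s' \<^bold>= t')"
    by (rule val_eq_euclid[OF v assms(2) val_eq_trans[OF v _ assms(3)]])
next
  assume "v (s' \<^bold>= t')"
  then show "v (s \<^bold>= t)"
    by (rule val_eq_trans[OF v val_eq_trans[OF v assms(2)] val_eq_sym[OF v assms(3)]])
qed

lemma provable_plus_right_cong: "\<turnstile> (s \<^bold>= t) \<^bold>\<Rightarrow> (Plus r s \<^bold>= Plus r t)"
proof (rule provable_right_cong)
  fix r s t show "\<turnstile> (Plus r s \<^bold>= Plus r t) \<^bold>\<Rightarrow> (Plus r (Succ s) \<^bold>= Plus r (Succ t))"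
  proof (rule provableI)
    fix v assume v: "val v"
    show "v ((Plus r s \<^bold>= Plus r t) \<^bold>\<Rightarrow> (Plus r (Succ s) \<^bold>= Plus r (Succ t)))"
      using v by (simp add: val_simps val_eq_cong[OF v val_plus_Succ[OF v] val_plus_Succ[OF v]] val_Succ)
  qed
qed simp

lemma provable_plus_left_cong: "\<turnstile> (s \<^bold>= t) \<^bold>\<Rightarrow> (Plus s r \<^bold>= Plus t r)"
proof (rule provable_left_cong)
  fix s t show "\<turnstile> (s \<^bold>= t) \<^bold>\<Rightarrow> (Plus s Zero \<^bold>= Plus t Zero)"
  proof (rule provableI)
    fix v assume v: "val v"
    show "v ((s \<^bold>= t) \<^bold>\<Rightarrow> (Plus s Zero \<^bold>= Plus t Zero))"
      using v by (simp add: val_simps val_eq_cong[OF v val_plus_Zero[OF v] val_plus_Zero[OF v]])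
  qed
  fix r show "\<turnstile> (s \<^bold>= t) \<^bold>\<Rightarrow> (Plus s r \<^bold>= Plus t r) \<^bold>\<Rightarrow> (Plus s (Succ r) \<^bold>= Plus t (Succ r))"
  proof (rule provableI)
    fix v assume v: "val v"
    show "v ((s \<^bold>= t) \<^bold>\<Rightarrow> (Plus s r \<^bold>= Plus t r) \<^bold>\<Rightarrow> (Plus s (Succ r) \<^bold>= Plus t (Succ r)))"
      using v by (simp add: val_simps val_eq_cong[OF v val_plus_Succ[OF v] val_plus_Succ[OF v]] val_Succ)
  qed
qed simp

lemma val_plus_cong:
  assumes v: "val v" and "v (s \<^bold>= s')" "v (t \<^bold>= t')"
  shows "v (Plus s t \<^bold>= Plus s' t')"
proof (rule val_eq_trans[OF v])
  show "v (Plus s t \<^bold>= Plus s' t)"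
    using val_provable[OF v provable_plus_left_cong[of s s' t]] assms by (simp add: val_simps)
  show "v (Plus s' t \<^bold>= Plus s' t')"
    using val_provable[OF v provable_plus_right_cong[of t t' s']] assms by (simp add: val_simps)
qed

lemma provable_times_right_cong: "\<turnstile> (s \<^bold>= t) \<^bold>\<Rightarrow> (Times r s \<^bold>= Times r t)"
proof (rule provable_right_cong)
  fix r s t show "\<turnstile> (Times r s \<^bold>= Times r t) \<^bold>\<Rightarrow> (Times r (Succ s) \<^bold>= Times r (Succ t))"
  proof (rule provableI)
    fix v assume v: "val v"
    show "v ((Times r s \<^bold>= Times r t) \<^bold>\<Rightarrow> (Times r (Succ s) \<^bold>= Times r (Succ t)))"
      using v by (simp add: val_simps val_eq_cong[OF v val_times_Succ[OF v] val_times_Succ[OF v]] val_plus_cong val_eq_refl)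
  qed
qed simp

lemma provable_times_left_cong: "\<turnstile> (s \<^bold>= t) \<^bold>\<Rightarrow> (Times s r \<^bold>= Times t r)"
proof (rule provable_left_cong)
  fix s t show "\<turnstile> (s \<^bold>= t) \<^bold>\<Rightarrow> (Times s Zero \<^bold>= Times t Zero)"
  proof (rule provableI)
    fix v assume v: "val v"
    show "v ((s \<^bold>= t) \<^bold>\<Rightarrow> (Times s Zero \<^bold>= Times t Zero))"
      using v by (simp add: val_simps val_eq_cong[OF v val_times_Zero[OF v] val_times_Zero[OF v]] val_eq_refl)
  qed
  fix r show "\<turnstile> (s \<^bold>= t) \<^bold>\<Rightarrow> (Times s r \<^bold>= Times t r) \<^bold>\<Rightarrow> (Times s (Succ r) \<^bold>= Times t (Succ r))"
  proof (rule provableI)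
    fix v assume v: "val v"
    show "v ((s \<^bold>= t) \<^bold>\<Rightarrow> (Times s r \<^bold>= Times t r) \<^bold>\<Rightarrow> (Times s (Succ r) \<^bold>= Times t (Succ r)))"
      using v by (simp add: val_simps val_eq_cong[OF v val_times_Succ[OF v] val_times_Succ[OF v]] val_plus_cong)
  qed
qed simp

lemma val_times_cong:
  assumes v: "val v" and "v (s \<^bold>= s')" "v (t \<^bold>= t')"
  shows "v (Times s t \<^bold>= Times s' t')"
proof (rule val_eq_trans[OF v])
  show "v (Times s t \<^bold>= Times s' t)"
    using val_provable[OF v provable_times_left_cong[of s s' t]] assms by (simp add: val_simps)
  show "v (Times s' t \<^bold>= Times s' t')"
    using val_provable[OF v provable_times_right_cong[of t t' s']] assms by (simp add: val_simps)
qed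

section \<open>Leibniz's law\<close>

lemma val_tsubst: "val v \<Longrightarrow> v (Var y \<^bold>= t) \<Longrightarrow> v (s \<^bold>= tsubst y t s)"
  by (induction s) (auto simp: val_eq_refl val_Succ val_plus_cong val_times_cong)

text \<open>At a quantifier with \<open>y\<close> free in the quantified formula,
  \<open>free_for\<close> keeps the bound variable out of \<open>t\<close>; it is thus not free in
  the equation, and the induction hypothesis passes under the quantifier. Otherwise substitution
  changes nothing.\<close>

lemma leibniz: "free_for t y F \<Longrightarrow> \<turnstile> (Var y \<^bold>= t) \<^bold>\<Rightarrow> Iff F (subst y t F)"
proof (induction F)
  case (Eq s u)
  show ?case
  proof (rule provableI)
    fix v assume v: "val v"
    then show "v ((Var y \<^bold>= t) \<^bold>\<Rightarrow> Iff (s \<^bold>= u) (subst y t (s \<^bold>= u)))"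
      using val_eq_cong[OF v val_tsubst[OF v, of y t s] val_tsubst[OF v, of y t u]]
      by (simp add: val_simps)
  qed
next
  case (Imp A B)
  then have "\<turnstile> (Var y \<^bold>= t) \<^bold>\<Rightarrow> Iff A (subst y t A)" "\<turnstile> (Var y \<^bold>= t) \<^bold>\<Rightarrow> Iff B (subst y t B)"
    by auto
  then show ?case by (rule taut2) (simp only: val_simps subst.simps; blast)
next
  case (And A B)
  then have "\<turnstile> (Var y \<^bold>= t) \<^bold>\<Rightarrow> Iff A (subst y t A)" "\<turnstile> (Var y \<^bold>= t) \<^bold>\<Rightarrow> Iff B (subst y t B)"
    by auto
  then show ?case by (rule taut2) (simp only: val_simps subst.simps; blast)
next
  case (Or A B)
  then have "\<turnstile> (Var y \<^bold>= t) \<^bold>\<Rightarrow> Iff A (subst y t A)" "\<turnstile> (Var y \<^bold>= t) \<^bold>\<Rightarrow> Iff B (subst y t B)"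
    by auto
  then show ?case by (rule taut2) (simp only: val_simps subst.simps; blast)
next
  case (Neg A)
  then have "\<turnstile> (Var y \<^bold>= t) \<^bold>\<Rightarrow> Iff A (subst y t A)"
    by auto
  then show ?case by (rule taut1) (simp only: val_simps subst.simps; blast)
next
  case (All w A)
  show ?case
  proof (cases "y \<in> fv (All w A)")
    case True
    with All have "\<turnstile> (Var y \<^bold>= t) \<^bold>\<Rightarrow> Iff A (subst y t A)" by auto
    with True All.prems show ?thesis using imp_Iff_all[of "Var y \<^bold>= t" A "subst y t A" w] by auto
  next
    case False
    then have "subst y t (All w A) = All w A" by (rule subst_fresh)
    then show ?thesis by (auto intro!: provableI simp: val_simps)
  qed
next
  case (Ex w A)
  show ?case
  proof (cases "y \<in> fv (Ex w A)")
    case True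
    with Ex have "\<turnstile> (Var y \<^bold>= t) \<^bold>\<Rightarrow> Iff A (subst y t A)" by auto
    with True Ex.prems show ?thesis using imp_Iff_ex[of "Var y \<^bold>= t" A "subst y t A" w] by auto
  next
    case False
    then have "subst y t (Ex w A) = Ex w A" by (rule subst_fresh)
    then show ?thesis by (auto intro!: provableI simp: val_simps)
  qed
qed

text \<open>Reflexivity provides a witness for \<exists>y with \<open>y\<close> equal to
  \<open>t\<close>, and the existential rule discharges the equation because \<open>y\<close> is not
  free in \<open>F\<close>.\<close>

lemma eq_elim: "\<turnstile> (Var y \<^bold>= t) \<^bold>\<Rightarrow> F \<Longrightarrow> y \<notin> tvars t \<Longrightarrow> y \<notin> fv F \<Longrightarrow> \<turnstile> F"
proof -
  assume F: "\<turnstile> (Var y \<^bold>= t) \<^bold>\<Rightarrow> F" and y: "y \<notin> tvars t" "y \<notin> fv F"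
  have "\<turnstile> t \<^bold>= t"
    by (rule provableI) (rule val_eq_refl)
  then have "\<turnstile> Ex y (Var y \<^bold>= t)"
    by (rule provable_mp) (use y provable_ax[OF ax.intros(13)[of t y "Var y \<^bold>= t"]] in simp)
  then show ?thesis
    by (rule provable_mp[OF _ ex_impI[OF F y(2)]])
qed

section \<open>Instances at numerals\<close>

section \<open>Numerals\<close>

lemma numeral_tm_simps [simp]: "\<lceil>0\<rceil>\<^sub>S = Zero" "\<lceil>Suc n\<rceil>\<^sub>S = Succ \<lceil>n\<rceil>\<^sub>S"
  by (simp_all add: numeral_tm_def)

lemma tvars_numeral [simp]: "tvars \<lceil>n\<rceil>\<^sub>S = {}"
  by (induction n) simp_all

text \<open>Links the conventional instance to literal substitution: Leibniz's law gives one
  direction, specialisation of the universal quantifier at the numeral the other.\<close>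

lemma num_inst_Iff: "\<turnstile> Iff (num_inst F y n) (subst y \<lceil>n\<rceil>\<^sub>S F)"
proof -
  let ?F = "subst y \<lceil>n\<rceil>\<^sub>S F"
  have L: "\<turnstile> (Var y \<^bold>= \<lceil>n\<rceil>\<^sub>S) \<^bold>\<Rightarrow> Iff F ?F"
    by (rule leibniz) simp
  have 1: "\<turnstile> ?F \<^bold>\<Rightarrow> num_inst F y n"
    unfolding num_inst_def
    by (rule imp_allI, rule provableI1[OF L]) (auto simp: val_simps dest: fv_substD)
  have "\<turnstile> num_inst F y n \<^bold>\<Rightarrow> (\<lceil>n\<rceil>\<^sub>S \<^bold>= \<lceil>n\<rceil>\<^sub>S) \<^bold>\<Rightarrow> ?F"
    unfolding num_inst_def
    using provable_ax[OF ax.intros(12)[of "\<lceil>n\<rceil>\<^sub>S" y "(Var y \<^bold>= \<lceil>n\<rceil>\<^sub>S) \<^bold>\<Rightarrow> F"]] by simp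
  with 1 show ?thesis
    by (rule provableI2) (auto simp: val_simps val_eq_refl)
qed

lemma num_inst_eq_Iff: "\<turnstile> (Var y \<^bold>= \<lceil>n\<rceil>\<^sub>S) \<^bold>\<Rightarrow> Iff F (num_inst F y n)"
proof -
  have "\<turnstile> (Var y \<^bold>= \<lceil>n\<rceil>\<^sub>S) \<^bold>\<Rightarrow> Iff F (subst y \<lceil>n\<rceil>\<^sub>S F)"
    by (rule leibniz) simp
  then show ?thesis
    by (rule taut2[OF num_inst_Iff[of F y n]]) (simp only: val_simps; blast)
qed

section \<open>Order relative to a fixed numeral\<close>

lemma provable_Zero_plus: "\<turnstile> Plus Zero (Var c) \<^bold>= Var c"
proof (rule provable_induct[of c])
  show "\<turnstile> subst c Zero (Plus Zero (Var c) \<^bold>= Var c)"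
    using provable_plus_Zero by simp
  have "\<turnstile> (Plus Zero (Var c) \<^bold>= Var c) \<^bold>\<Rightarrow> (Plus Zero (Succ (Var c)) \<^bold>= Succ (Var c))"
  proof (rule provableI)
    fix v assume v: "val v"
    show "v ((Plus Zero (Var c) \<^bold>= Var c) \<^bold>\<Rightarrow> (Plus Zero (Succ (Var c)) \<^bold>= Succ (Var c)))"
      using v by (simp add: val_simps val_eq_cong[OF v val_plus_Succ[OF v] val_eq_refl[OF v]] val_Succ)
  qed
  then show "\<turnstile> (Plus Zero (Var c) \<^bold>= Var c) \<^bold>\<Rightarrow> subst c (Succ (Var c)) (Plus Zero (Var c) \<^bold>= Var c)"
    by simp
qed

text \<open>The axioms move a successor out of the right summand only. This left version lets
  \<open>geq_numeral_cases\<close> shift a successor from the witness to the numeral.\<close>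

lemma provable_Succ_plus:
  assumes x: "x \<notin> tvars s"
  shows "\<turnstile> Plus (Succ s) (Var x) \<^bold>= Succ (Plus s (Var x))"
proof (rule provable_induct[of x])
  have "\<turnstile> Plus (Succ s) Zero \<^bold>= Succ (Plus s Zero)"
  proof (rule provableI)
    fix v assume v: "val v"
    show "v (Plus (Succ s) Zero \<^bold>= Succ (Plus s Zero))"
      using val_eq_cong[OF v val_plus_Zero[OF v] val_eq_refl[OF v]]
        val_eq_sym[OF v val_plus_Zero[OF v]] by (simp add: val_Succ[OF v])
  qed
  then show "\<turnstile> subst x Zero (Plus (Succ s) (Var x) \<^bold>= Succ (Plus s (Var x)))"
    using x by simp
  have "\<turnstile> (Plus (Succ s) (Var x) \<^bold>= Succ (Plus s (Var x))) \<^bold>\<Rightarrow>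
      (Plus (Succ s) (Succ (Var x)) \<^bold>= Succ (Plus s (Succ (Var x))))"
  proof (rule provableI)
    fix v assume v: "val v"
    have "v (Plus (Succ s) (Succ (Var x)) \<^bold>= Succ (Plus s (Succ (Var x)))) \<longleftrightarrow>
        v (Succ (Plus (Succ s) (Var x)) \<^bold>= Succ (Succ (Plus s (Var x))))"
      by (rule val_eq_cong[OF v]) (simp_all add: val_Succ[OF v] val_plus_Succ[OF v])
    then show "v ((Plus (Succ s) (Var x) \<^bold>= Succ (Plus s (Var x))) \<^bold>\<Rightarrow>
        (Plus (Succ s) (Succ (Var x)) \<^bold>= Succ (Plus s (Succ (Var x)))))"
      using v by (simp add: val_simps val_Succ)
  qed
  then show "\<turnstile> (Plus (Succ s) (Var x) \<^bold>= Succ (Plus s (Var x))) \<^bold>\<Rightarrow>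
      subst x (Succ (Var x)) (Plus (Succ s) (Var x) \<^bold>= Succ (Plus s (Var x)))"
    using x by simp
qed

text \<open>Induction on \<open>n\<close> outside S, with a case distinction on the witness
  \<open>x\<close> inside S: zero means that \<open>c\<close> equals the numeral, a successor
  cancels down to the previous numeral. The arbitrary conclusion \<open>K\<close> replaces a finite
  disjunction.\<close>

lemma leq_numeral_cases:
  assumes "\<And>k. k \<le> n \<Longrightarrow> \<turnstile> (Var c \<^bold>= \<lceil>k\<rceil>\<^sub>S) \<^bold>\<Rightarrow> K" and x: "x \<notin> fv K" "x \<noteq> c"
  shows "\<turnstile> leq_fm x (Var c) \<lceil>n\<rceil>\<^sub>S \<^bold>\<Rightarrow> K"
proof -
  have "\<turnstile> (Plus (Var c) (Var x) \<^bold>= \<lceil>n\<rceil>\<^sub>S) \<^bold>\<Rightarrow> K"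
    using assms(1)
  proof (induction n)
    case (0)
    have "\<turnstile> (Plus (Var c) Zero \<^bold>= Zero) \<^bold>\<Rightarrow> K"
      by (rule provableI2[OF 0[of 0] provable_plus_Zero[of "Var c"]])
        (auto simp: val_simps intro: val_eq_euclid)
    moreover have "\<turnstile> (Plus (Var c) (Succ (Var x)) \<^bold>= Zero) \<^bold>\<Rightarrow> K"
    proof (rule provableI)
      fix v assume v: "val v"
      show "v ((Plus (Var c) (Succ (Var x)) \<^bold>= Zero) \<^bold>\<Rightarrow> K)"
        using v by (simp add: val_simps val_eq_cong[OF v val_plus_Succ[OF v] val_eq_refl[OF v]]
            val_Succ_not_Zero)
    qed
    ultimately show ?case
      using x by - (rule provable_cases[of x], simp_all)
  next
    case (Suc n)
    have "\<turnstile> (Plus (Var c) Zero \<^bold>= \<lceil>Suc n\<rceil>\<^sub>S) \<^bold>\<Rightarrow> K"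
      by (rule provableI2[OF Suc.prems[of "Suc n"] provable_plus_Zero[of "Var c"]])
        (auto simp: val_simps intro: val_eq_euclid)
    moreover have IH: "\<turnstile> (Plus (Var c) (Var x) \<^bold>= \<lceil>n\<rceil>\<^sub>S) \<^bold>\<Rightarrow> K"
      using Suc by simp
    have "\<turnstile> (Plus (Var c) (Succ (Var x)) \<^bold>= \<lceil>Suc n\<rceil>\<^sub>S) \<^bold>\<Rightarrow> K"
    proof (rule provableI1[OF IH])
      fix v assume v: "val v" and "v ((Plus (Var c) (Var x) \<^bold>= \<lceil>n\<rceil>\<^sub>S) \<^bold>\<Rightarrow> K)"
      then show "v ((Plus (Var c) (Succ (Var x)) \<^bold>= \<lceil>Suc n\<rceil>\<^sub>S) \<^bold>\<Rightarrow> K)"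
        by (simp add: val_simps val_eq_cong[OF v val_plus_Succ[OF v] val_eq_refl[OF v]] val_Succ)
    qed
    ultimately show ?case
      using x by - (rule provable_cases[of x], simp_all)
  qed
  then show ?thesis
    unfolding leq_fm_def using x by (intro ex_impI)
qed

text \<open>Also by induction on \<open>n\<close>. Zero is below everything. In the step, a witness
  for the bound \<open>n\<close> is zero, giving the case \<open>k = n\<close>, or a successor,
  giving the bound \<open>Suc n\<close>; so \<open>K\<close> follows from the bound \<open>n\<close>
  as well.\<close>

lemma geq_numeral_cases:
  assumes "\<And>k. k < n \<Longrightarrow> \<turnstile> (Var c \<^bold>= \<lceil>k\<rceil>\<^sub>S) \<^bold>\<Rightarrow> K"
    and "\<turnstile> leq_fm x \<lceil>n\<rceil>\<^sub>S (Var c) \<^bold>\<Rightarrow> K" and x: "x \<notin> fv K" "x \<noteq> c"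
  shows "\<turnstile> K"
  using assms(1,2)
proof (induction n)
  case 0
  have "\<turnstile> leq_fm x Zero (Var c)"
    unfolding leq_fm_def
    by (rule provable_mp[OF provable_Zero_plus[of c]])
      (use x provable_ax[OF ax.intros(13)[of "Var c" x "Plus Zero (Var x) \<^bold>= Var c"]] in simp)
  then show ?case
    by (rule provable_mp) (use 0 in simp)
next
  case (Suc n)
  have n: "\<turnstile> (Var c \<^bold>= \<lceil>n\<rceil>\<^sub>S) \<^bold>\<Rightarrow> K"
    using Suc.prems(1)[of n] by simp
  have "\<turnstile> (Plus \<lceil>n\<rceil>\<^sub>S Zero \<^bold>= Var c) \<^bold>\<Rightarrow> K"
    by (rule provableI2[OF n provable_plus_Zero[of "\<lceil>n\<rceil>\<^sub>S"]])
      (auto simp: val_simps intro: val_eq_euclid)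
  moreover have "\<turnstile> (Plus \<lceil>Suc n\<rceil>\<^sub>S (Var x) \<^bold>= Var c) \<^bold>\<Rightarrow> K"
    by (rule provableI2[OF ex_intro[of "Plus \<lceil>Suc n\<rceil>\<^sub>S (Var x) \<^bold>= Var c" x] Suc.prems(2)[unfolded leq_fm_def]]) (simp add: val_simps)
  then have "\<turnstile> (Plus \<lceil>n\<rceil>\<^sub>S (Succ (Var x)) \<^bold>= Var c) \<^bold>\<Rightarrow> K"
  proof (rule provableI2[OF provable_Succ_plus[of x "\<lceil>n\<rceil>\<^sub>S"], rotated])
    fix v assume v: "val v" and S: "v (Plus (Succ \<lceil>n\<rceil>\<^sub>S) (Var x) \<^bold>= Succ (Plus \<lceil>n\<rceil>\<^sub>S (Var x)))"
      and "v ((Plus \<lceil>Suc n\<rceil>\<^sub>S (Var x) \<^bold>= Var c) \<^bold>\<Rightarrow> K)"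
    then show "v ((Plus \<lceil>n\<rceil>\<^sub>S (Succ (Var x)) \<^bold>= Var c) \<^bold>\<Rightarrow> K)"
      using val_eq_cong[OF v val_plus_Succ[OF v] val_eq_refl[OF v]]
        val_eq_cong[OF v S val_eq_refl[OF v]]
      by (simp add: val_simps)
  qed simp
  ultimately have "\<turnstile> (Plus \<lceil>n\<rceil>\<^sub>S (Var x) \<^bold>= Var c) \<^bold>\<Rightarrow> K"
    using x by - (rule provable_cases[of x], simp_all)
  then have "\<turnstile> leq_fm x \<lceil>n\<rceil>\<^sub>S (Var c) \<^bold>\<Rightarrow> K"
    unfolding leq_fm_def using x by (intro ex_impI)
  then show ?case
    using Suc by simp
qed

section \<open>Change of bound variables up to provable equivalence\<close>

section \<open>Renaming of bound variables\<close>

text \<open>Specialising \<open>All y A\<close> at \<open>y\<close> itself leaves an equation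
  between \<open>y\<close> and \<open>z\<close> as hypothesis, which \<open>eq_elim\<close> removes
  since \<open>y\<close> is free neither in \<open>All y A\<close> nor in \<open>B\<close>.\<close>

lemma all_alpha:
  assumes "\<turnstile> (Var y \<^bold>= Var z) \<^bold>\<Rightarrow> A \<^bold>\<Rightarrow> B" and "y \<noteq> z" "y \<notin> fv B" "z \<notin> fv A"
  shows "\<turnstile> All y A \<^bold>\<Rightarrow> All z B"
proof -
  have "\<turnstile> (Var y \<^bold>= Var z) \<^bold>\<Rightarrow> All y A \<^bold>\<Rightarrow> B"
    by (rule provableI2[OF assms(1) all_elim[of y A]]) (simp add: val_simps)
  then have "\<turnstile> All y A \<^bold>\<Rightarrow> B"
    by (rule eq_elim) (use assms in auto)
  then show ?thesis
    by (rule imp_allI) (use assms in auto)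
qed

text \<open>The equation is turned round because here \<open>z\<close> is the variable to eliminate:
  it is bound in \<open>Ex z B\<close> and not free in \<open>A\<close>.\<close>

lemma ex_alpha:
  assumes "\<turnstile> (Var z \<^bold>= Var y) \<^bold>\<Rightarrow> A \<^bold>\<Rightarrow> B" and "y \<noteq> z" "y \<notin> fv B" "z \<notin> fv A"
  shows "\<turnstile> Ex y A \<^bold>\<Rightarrow> Ex z B"
proof -
  have "\<turnstile> (Var z \<^bold>= Var y) \<^bold>\<Rightarrow> A \<^bold>\<Rightarrow> Ex z B"
    by (rule provableI2[OF assms(1) ex_intro[of B z]]) (simp add: val_simps)
  then have "\<turnstile> A \<^bold>\<Rightarrow> Ex z B"
    by (rule eq_elim) (use assms in auto)
  then show ?thesis
    by (rule ex_impI) (use assms in auto)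
qed

lemma alpha_Iff:
  assumes AB: "\<turnstile> (Var y \<^bold>= Var z) \<^bold>\<Rightarrow> Iff A B" and yz: "y \<noteq> z" "y \<notin> fv B" "z \<notin> fv A"
  shows "\<turnstile> Iff (All y A) (All z B)" and "\<turnstile> Iff (Ex y A) (Ex z B)"
proof -
  have 1: "\<turnstile> (Var y \<^bold>= Var z) \<^bold>\<Rightarrow> A \<^bold>\<Rightarrow> B" and 2: "\<turnstile> (Var y \<^bold>= Var z) \<^bold>\<Rightarrow> B \<^bold>\<Rightarrow> A"
    and 3: "\<turnstile> (Var z \<^bold>= Var y) \<^bold>\<Rightarrow> A \<^bold>\<Rightarrow> B" and 4: "\<turnstile> (Var z \<^bold>= Var y) \<^bold>\<Rightarrow> B \<^bold>\<Rightarrow> A"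
    by (rule provableI1[OF AB]; auto simp: val_simps dest: val_eq_sym)+
  show "\<turnstile> Iff (All y A) (All z B)"
    by (rule provableI2[OF all_alpha[OF 1 yz] all_alpha[OF 4 yz(1)[symmetric] yz(3,2)]])
      (simp add: val_simps)
  show "\<turnstile> Iff (Ex y A) (Ex z B)"
    by (rule provableI2[OF ex_alpha[OF 3 yz] ex_alpha[OF 2 yz(1)[symmetric] yz(3,2)]])
      (simp add: val_simps)
qed

lemma fv_subset_all_vars: "fv F \<subseteq> all_vars F"
  by (induction F) auto

lemma finite_all_vars [simp]: "finite (all_vars F)"
  by (induction F) auto

lemma fv_rename_bound: "v \<in> fv (rename_bound y z F) \<Longrightarrow> v \<in> fv F"
  by (induction F) (auto split: if_splits dest: fv_substD)

text \<open>Quantifiers over the fresh \<open>z\<close> arise only from quantifiers over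
  \<open>y\<close>, and \<open>y\<close> is no longer free in their scopes.\<close>

lemma free_for_rename_bound:
  "z \<notin> all_vars F \<Longrightarrow> y \<noteq> z \<Longrightarrow> free_for (Var z) y (rename_bound y z F)"
  by (induction F) (auto dest: fv_substD)

lemma free_for_subst_Var:
  "free_for (Var c) b F \<Longrightarrow> b \<noteq> z \<Longrightarrow> free_for (Var c) b (subst c (Var z) F)"
  by (induction F) (auto dest: fv_substD)

text \<open>After the renaming no quantifier binds \<open>c\<close>, so \<open>c\<close> cannot be
  captured.\<close>

lemma free_for_rename_bound_old:
  "b \<noteq> z \<Longrightarrow> z \<noteq> c \<Longrightarrow> free_for (Var c) b (rename_bound c z F)"
  by (induction F) (auto intro: free_for_subst_Var)

text \<open>At a quantifier over \<open>y\<close>, Leibniz's law relates the two scopes under the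
  equation of \<open>y\<close> and \<open>z\<close>, which is the premise of
  \<open>alpha_Iff\<close>.\<close>

lemma rename_bound_Iff: "z \<notin> all_vars F \<Longrightarrow> y \<noteq> z \<Longrightarrow> \<turnstile> Iff F (rename_bound y z F)"
proof (induction F)
  case (Eq s t)
  show ?case by (rule provableI) (simp add: val_simps)
next
  case (Imp A B)
  then have "\<turnstile> Iff A (rename_bound y z A)" "\<turnstile> Iff B (rename_bound y z B)" by auto
  then show ?case by (rule taut2) (simp only: val_simps rename_bound.simps; blast)
next
  case (And A B)
  then have "\<turnstile> Iff A (rename_bound y z A)" "\<turnstile> Iff B (rename_bound y z B)" by auto
  then show ?case by (rule taut2) (simp only: val_simps rename_bound.simps; blast)
next
  case (Or A B)
  then have "\<turnstile> Iff A (rename_bound y z A)" "\<turnstile> Iff B (rename_bound y z B)" by auto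
  then show ?case by (rule taut2) (simp only: val_simps rename_bound.simps; blast)
next
  case (Neg A)
  then have "\<turnstile> Iff A (rename_bound y z A)" by auto
  then show ?case by (rule taut1) (simp only: val_simps rename_bound.simps; blast)
next
  case (All w A)
  let ?A = "rename_bound y z A"
  have z: "z \<notin> all_vars A" "z \<notin> fv A"
    using All.prems(1) fv_subset_all_vars[of A] by auto
  note IH = All.IH[OF z(1) All.prems(2)]
  show ?case
  proof (cases "w = y")
    case True
    have "\<turnstile> (Var y \<^bold>= Var z) \<^bold>\<Rightarrow> Iff A (subst y (Var z) ?A)"
      by (rule taut2[OF IH leibniz[OF free_for_rename_bound[OF z(1) All.prems(2)]]])
        (simp only: val_simps; blast)
    moreover have "y \<notin> fv (subst y (Var z) ?A)"
      using All.prems by (auto dest: fv_substD)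
    ultimately have "\<turnstile> Iff (All y A) (All z (subst y (Var z) ?A))"
      using All.prems z by (intro alpha_Iff(1))
    with True show ?thesis by simp
  next
    case False
    with Iff_all[OF IH] show ?thesis by simp
  qed
next
  case (Ex w A)
  let ?A = "rename_bound y z A"
  have z: "z \<notin> all_vars A" "z \<notin> fv A"
    using Ex.prems(1) fv_subset_all_vars[of A] by auto
  note IH = Ex.IH[OF z(1) Ex.prems(2)]
  show ?case
  proof (cases "w = y")
    case True
    have "\<turnstile> (Var y \<^bold>= Var z) \<^bold>\<Rightarrow> Iff A (subst y (Var z) ?A)"
      by (rule taut2[OF IH leibniz[OF free_for_rename_bound[OF z(1) Ex.prems(2)]]])
        (simp only: val_simps; blast)
    moreover have "y \<notin> fv (subst y (Var z) ?A)"
      using Ex.prems by (auto dest: fv_substD)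
    ultimately have "\<turnstile> Iff (Ex y A) (Ex z (subst y (Var z) ?A))"
      using Ex.prems z by (intro alpha_Iff(2))
    with True show ?thesis by simp
  next
    case False
    with Iff_ex[OF IH] show ?thesis by simp
  qed
qed

lemma var_inst_fresh:
  fixes F :: fm and b c :: var
  defines "z \<equiv> LEAST z. z \<notin> all_vars F \<union> {b, c}"
  shows "z \<notin> all_vars F" "z \<noteq> b" "z \<noteq> c"
proof -
  have "z \<notin> all_vars F \<union> {b, c}"
    unfolding z_def by (rule LeastI_ex, rule fresh_var) simp
  then show "z \<notin> all_vars F" "z \<noteq> b" "z \<noteq> c" by auto
qed

text \<open>Leibniz's law in both branches of \<open>var_inst\<close>; in the second it is applied
  after the renaming, which preserves \<open>F\<close> up to provable equivalence.\<close>

lemma var_inst_Iff: "b \<noteq> c \<Longrightarrow> \<turnstile> (Var b \<^bold>= Var c) \<^bold>\<Rightarrow> Iff F (var_inst F b c)"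
proof (cases "free_for (Var c) b F")
  case True
  then show ?thesis by (simp add: var_inst_def leibniz)
next
  case False
  assume bc: "b \<noteq> c"
  let ?z = "LEAST z. z \<notin> all_vars F \<union> {b, c}"
  note z = var_inst_fresh[of F b c]
  have "\<turnstile> Iff F (rename_bound c ?z F)"
    by (rule rename_bound_Iff[OF z(1) z(3)[symmetric]])
  moreover have "\<turnstile> (Var b \<^bold>= Var c) \<^bold>\<Rightarrow>
      Iff (rename_bound c ?z F) (subst b (Var c) (rename_bound c ?z F))"
    by (rule leibniz[OF free_for_rename_bound_old[OF z(2)[symmetric] z(3)]])
  ultimately have "\<turnstile> (Var b \<^bold>= Var c) \<^bold>\<Rightarrow> Iff F (subst b (Var c) (rename_bound c ?z F))"
    by (rule taut2) (simp only: val_simps; blast)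
  with False show ?thesis by (simp only: var_inst_def if_False)
qed

lemma fv_var_inst: "fv (var_inst F b c) \<subseteq> fv F - {b} \<union> {c}"
  by (auto simp: var_inst_def split: if_splits dest!: fv_substD fv_rename_bound)

section \<open>Injectivity of the Goedel numbering on strings of symbols\<close>

section \<open>Unique readability\<close>

lemma gnum_less: "gnum e < 2 ^ floorlog 2 (gnum e)"
  by (rule floorlog_leD) simp_all

lemma symb_num_inj: "symb_num s = symb_num t \<Longrightarrow> s = t"
  by (cases s; cases t) simp_all

lemma symb_num_power: "\<exists>k. symb_num s = 2 ^ k"
  by (cases s) (simp_all only: symb_num.simps, blast+)

text \<open>The leading binary digit of the Goedel number of \<open>s # e\<close> is contributed by \<open>s\<close> alone, so
  removing it leaves the Goedel number of \<open>e\<close>.\<close>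

lemma gnum_Cons:
  "\<exists>k. gnum (s # e) = 2 ^ k + gnum e \<and> gnum e < 2 ^ k \<and> 2 ^ k = 2 ^ floorlog 2 (gnum e) * symb_num s"
proof -
  obtain k where k: "symb_num s = 2 ^ k" using symb_num_power by blast
  have "gnum e < 2 ^ (floorlog 2 (gnum e) + k)"
    using gnum_less[of e] by (rule less_le_trans) (simp add: power_increasing)
  then show ?thesis
    using k by (intro exI[of _ "floorlog 2 (gnum e) + k"]) (simp add: star_def power_add)
qed

lemma leading_power_unique:
  assumes "2 ^ k + u = 2 ^ l + (w::nat)" "u < 2 ^ k" "w < 2 ^ l"
  shows "k = l"
proof (rule ccontr)
  have *: False if "i < j" "2 ^ i + x = 2 ^ j + (y::nat)" "x < 2 ^ i" for i j x y
  proof -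
    have "(2::nat) ^ Suc i \<le> 2 ^ j" using that(1) by (intro power_increasing) auto
    with that show False by simp
  qed
  assume "k \<noteq> l"
  then show False
    using *[of k l u w] *[of l k w u] assms by (auto simp: neq_iff)
qed

text \<open>Equal numbers have equal leading digits, hence equal remainders, and the tails agree by
  induction. With equal tails the position of the leading digit determines the first symbol.\<close>

lemma gnum_inj: "gnum e = gnum f \<Longrightarrow> e = f"
proof (induction e arbitrary: f)
  case Nil
  show ?case
  proof (cases f)
    case (Cons t f')
    then obtain k where "gnum f = 2 ^ k + gnum f'" using gnum_Cons by blast
    with Nil show ?thesis by simp
  qed simp
next
  case (Cons s e)
  obtain k where k: "gnum (s # e) = 2 ^ k + gnum e" "gnum e < 2 ^ k"
      "2 ^ k = 2 ^ floorlog 2 (gnum e) * symb_num s"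
    using gnum_Cons by blast
  from k(1) Cons.prems have "gnum f \<noteq> 0" by (simp del: gnum.simps)
  then obtain t f' where f: "f = t # f'" by (cases f) auto
  obtain l where l: "gnum (t # f') = 2 ^ l + gnum f'" "gnum f' < 2 ^ l"
      "2 ^ l = 2 ^ floorlog 2 (gnum f') * symb_num t"
    using gnum_Cons by blast
  have eq: "2 ^ k + gnum e = 2 ^ l + gnum f'"
    using Cons.prems f k(1) l(1) by (simp del: gnum.simps)
  then have "k = l"
    using k(2) l(2) by (rule leading_power_unique)
  with eq have "gnum e = gnum f'" by simp
  moreover from this have "e = f'" by (rule Cons.IH)
  ultimately show ?case
    using k(3) l(3) \<open>k = l\<close> f symb_num_inj by auto
qed

section \<open>Parenthesised terms and formulae as prefix codes\<close>

lemma replicate_append_inj: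
  "replicate m SPrime @ RParen # r = replicate n SPrime @ RParen # r' \<Longrightarrow> m = n \<and> r = r'"
proof (induction m arbitrary: n)
  case 0
  then show ?case by (cases n) auto
next
  case (Suc m)
  then show ?case by (cases n) auto
qed

lemma var_expr_inj: "var_expr x @ r = var_expr y @ r' \<Longrightarrow> x = y \<and> r = r'"
  by (auto simp: var_expr_def paren_def dest: replicate_append_inj)

declare tm_expr.simps [simp del] fm_expr.simps [simp del]

lemma paren_neq: "s \<noteq> LParen \<Longrightarrow> paren e @ r \<noteq> s # r'" "s \<noteq> LParen \<Longrightarrow> s # r' \<noteq> paren e @ r"
  by (auto simp: paren_def)

text \<open>Exposes the leading symbols in front of an arbitrary continuation \<open>r\<close>, so
  that two expressions can be compared from the left.\<close>

lemma paren_tm_expr: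
  "paren (tm_expr Zero) @ r = LParen # SZero # RParen # r"
  "paren (tm_expr (Var x)) @ r =
     LParen # LParen # SZero # SPrime # replicate x SPrime @ RParen # RParen # r"
  "paren (tm_expr (Succ s)) @ r = LParen # paren (tm_expr s) @ SPrime # RParen # r"
  "paren (tm_expr (Plus s t)) @ r =
     LParen # paren (tm_expr s) @ SPlus # paren (tm_expr t) @ RParen # r"
  "paren (tm_expr (Times s t)) @ r =
     LParen # paren (tm_expr s) @ STimes # paren (tm_expr t) @ RParen # r"
  by (simp_all add: paren_def var_expr_def tm_expr.simps)

text \<open>The free continuations let the induction hypothesis split off the first subterm whatever
  follows it; the operation symbol is then compared.\<close>

lemma paren_tm_expr_inj: "paren (tm_expr s) @ r = paren (tm_expr t) @ r' \<Longrightarrow> s = t \<and> r = r'"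
proof (induction s arbitrary: t r r')
  case Zero
  then show ?case by (cases t) (simp_all add: paren_tm_expr paren_neq)
next
  case (Var x)
  show ?case
  \<comment> \<open>A compound term also begins with two left parentheses; the form of its first
    subterm separates it from a variable.\<close>
  proof (cases t)
    case (Succ u)
    with Var show ?thesis by (cases u) (simp_all add: paren_tm_expr paren_neq)
  next
    case (Plus u w)
    with Var show ?thesis by (cases u) (simp_all add: paren_tm_expr paren_neq)
  next
    case (Times u w)
    with Var show ?thesis by (cases u) (simp_all add: paren_tm_expr paren_neq)
  qed (use Var in \<open>auto simp: paren_tm_expr dest: replicate_append_inj\<close>)
next
  case (Succ s)
  show ?case
  proof (cases t)
    case Zero
    with Succ.prems show ?thesis by (simp add: paren_tm_expr paren_neq)
  next
    case (Var x)
    with Succ.prems show ?thesis by (cases s) (simp_all add: paren_tm_expr paren_neq)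
  qed (use Succ.prems in \<open>auto simp: paren_tm_expr dest!: Succ.IH\<close>)
next
  case (Plus s1 s2)
  show ?case
  proof (cases t)
    case Zero
    with Plus.prems show ?thesis by (simp add: paren_tm_expr paren_neq)
  next
    case (Var x)
    with Plus.prems show ?thesis by (cases s1) (simp_all add: paren_tm_expr paren_neq)
  qed (use Plus.prems in \<open>auto simp: paren_tm_expr dest!: Plus.IH\<close>)
next
  case (Times s1 s2)
  show ?case
  proof (cases t)
    case Zero
    with Times.prems show ?thesis by (simp add: paren_tm_expr paren_neq)
  next
    case (Var x)
    with Times.prems show ?thesis by (cases s1) (simp_all add: paren_tm_expr paren_neq)
  qed (use Times.prems in \<open>auto simp: paren_tm_expr dest!: Times.IH\<close>)
qed

lemma paren_fm_expr:
  "paren (fm_expr (s \<^bold>= t)) @ r = LParen # paren (tm_expr s) @ SEq # paren (tm_expr t) @ RParen # r"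
  "paren (fm_expr (A \<^bold>\<Rightarrow> B)) @ r = LParen # paren (fm_expr A) @ SImp # paren (fm_expr B) @ RParen # r"
  "paren (fm_expr (A \<^bold>\<and> B)) @ r = LParen # paren (fm_expr A) @ SAnd # paren (fm_expr B) @ RParen # r"
  "paren (fm_expr (A \<^bold>\<or> B)) @ r = LParen # paren (fm_expr A) @ SOr # paren (fm_expr B) @ RParen # r"
  "paren (fm_expr (Neg A)) @ r = LParen # SNeg # paren (fm_expr A) @ RParen # r"
  "paren (fm_expr (All x A)) @ r = LParen # SAll # var_expr x @ paren (fm_expr A) @ RParen # r"
  "paren (fm_expr (Ex x A)) @ r = LParen # SEx # var_expr x @ paren (fm_expr A) @ RParen # r"
  by (simp_all add: paren_def fm_expr.simps)

text \<open>Separates an equation, which begins with a parenthesised term, from a binary connective,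
  which begins with a parenthesised formula.\<close>

lemma paren_tm_expr_neq_fm_expr: "paren (tm_expr s) @ r \<noteq> paren (fm_expr A) @ r'"
proof (induction s arbitrary: A r r')
  case Zero
  show ?case by (cases A) (auto simp: paren_tm_expr paren_fm_expr paren_neq)
next
  case (Var x)
  \<comment> \<open>Inside its outer parentheses a variable is itself parenthesised and starts with
    zero and a prime; no parenthesised term or formula begins in that way.\<close>
  have tm: "LParen # SZero # SPrime # e \<noteq> paren (tm_expr t) @ f" for t e f
    by (cases t) (simp_all add: paren_tm_expr paren_neq)
  have fm: "LParen # SZero # SPrime # e \<noteq> paren (fm_expr B) @ f" for B e f
    by (cases B) (simp_all add: paren_fm_expr paren_neq)
  show ?case by (cases A) (auto simp: paren_tm_expr paren_fm_expr paren_neq tm fm)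
next
  case (Succ s)
  then show ?case
    by (cases A) (auto simp: paren_tm_expr paren_fm_expr paren_neq dest!: paren_tm_expr_inj)
next
  case (Plus s1 s2)
  then show ?case
    by (cases A) (auto simp: paren_tm_expr paren_fm_expr paren_neq dest!: paren_tm_expr_inj)
next
  case (Times s1 s2)
  then show ?case
    by (cases A) (auto simp: paren_tm_expr paren_fm_expr paren_neq dest!: paren_tm_expr_inj)
qed

lemma paren_fm_expr_inj: "paren (fm_expr A) @ r = paren (fm_expr B) @ r' \<Longrightarrow> A = B \<and> r = r'"
proof (induction A arbitrary: B r r')
  case (Eq s t)
  then show ?case
    by (cases B) (auto simp: paren_fm_expr paren_neq paren_tm_expr_neq_fm_expr dest!: paren_tm_expr_inj)
next
  case (Imp A1 A2)
  from Imp.prems show ?case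
    by (cases B) (auto simp: paren_fm_expr paren_neq paren_tm_expr_neq_fm_expr[symmetric] dest!: Imp.IH)
next
  case (And A1 A2)
  from And.prems show ?case
    by (cases B) (auto simp: paren_fm_expr paren_neq paren_tm_expr_neq_fm_expr[symmetric] dest!: And.IH)
next
  case (Or A1 A2)
  from Or.prems show ?case
    by (cases B) (auto simp: paren_fm_expr paren_neq paren_tm_expr_neq_fm_expr[symmetric] dest!: Or.IH)
next
  case (Neg A)
  from Neg.prems show ?case
    by (cases B) (auto simp: paren_fm_expr paren_neq dest!: Neg.IH)
next
  case (All x A)
  from All.prems show ?case
    by (cases B) (auto simp: paren_fm_expr paren_neq dest!: var_expr_inj All.IH)
next
  case (Ex x A)
  from Ex.prems show ?case
    by (cases B) (auto simp: paren_fm_expr paren_neq dest!: var_expr_inj Ex.IH)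
qed

lemma gnum_fm_expr_inj: "gnum (fm_expr A) = gnum (fm_expr B) \<Longrightarrow> A = B"
  using paren_fm_expr_inj[of A "[]" B "[]"] gnum_inj by fastforce

section \<open>The two halves of Rosser's argument and their combination\<close>

section \<open>The Rosser argument\<close>

lemma fv_num_inst: "fv (num_inst F y n) = fv F - {y}"
  by (auto simp: num_inst_def)

text \<open>Both forms are compared with the literal substitution of the numeral for
  \<open>va\<close>, which passes under the quantifiers over \<open>vb\<close> and \<open>vc\<close>
  and leaves the order formula unchanged.\<close>

lemma rosser_sentence_Iff:
  "\<turnstile> Iff (rosser_sentence g h x q) (num_inst (rosser_fm g h x) va q)"
proof -
  let ?L = "leq_fm x (Var vc) (Var vb)" and ?h = "var_inst h vb vc"
  let ?s = "subst va \<lceil>q\<rceil>\<^sub>S"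
  have "\<turnstile> Iff (?L \<^bold>\<and> num_inst ?h va q) (?L \<^bold>\<and> ?s ?h)"
    by (rule taut1[OF num_inst_Iff[of ?h va q]]) (simp only: val_simps; blast)
  then have "\<turnstile> Iff (Ex vc (?L \<^bold>\<and> num_inst ?h va q)) (Ex vc (?L \<^bold>\<and> ?s ?h))"
    by (rule Iff_ex)
  then have "\<turnstile> Iff (num_inst g va q \<^bold>\<Rightarrow> Ex vc (?L \<^bold>\<and> num_inst ?h va q))
      (?s g \<^bold>\<Rightarrow> Ex vc (?L \<^bold>\<and> ?s ?h))"
    by (rule taut2[OF num_inst_Iff[of g va q]]) (simp only: val_simps; blast)
  then have "\<turnstile> Iff (rosser_sentence g h x q) (All vb (?s g \<^bold>\<Rightarrow> Ex vc (?L \<^bold>\<and> ?s ?h)))"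
    unfolding rosser_sentence_def by (rule Iff_all)
  moreover have "?s (rosser_fm g h x) = All vb (?s g \<^bold>\<Rightarrow> Ex vc (?L \<^bold>\<and> ?s ?h))"
    by (simp add: rosser_fm_def leq_fm_def va_def vb_def vc_def)
  then have "\<turnstile> Iff (num_inst (rosser_fm g h x) va q) (All vb (?s g \<^bold>\<Rightarrow> Ex vc (?L \<^bold>\<and> ?s ?h)))"
    using num_inst_Iff[of "rosser_fm g h x" va q] by simp
  ultimately show ?thesis
    by (rule taut2) (simp only: val_simps; blast)
qed

text \<open>The Rosser formula uses \<open>h\<close> at \<open>vc\<close>, while numeralwise
  expressibility speaks of numerals put for \<open>vb\<close>. The two are linked by equating
  \<open>vb\<close> with \<open>vc\<close>; as \<open>vb\<close> is free in neither instance, that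
  equation is then discharged.\<close>

lemma var_inst_eq_Iff:
  "\<turnstile> (Var vc \<^bold>= \<lceil>k\<rceil>\<^sub>S) \<^bold>\<Rightarrow>
     Iff (num_inst (var_inst h vb vc) va q) (num_inst (num_inst h va q) vb k)"
proof -
  let ?h = "var_inst h vb vc" and ?E = "Var va \<^bold>= \<lceil>q\<rceil>\<^sub>S"
  have "vb \<noteq> vc" by (simp add: vb_def vc_def)
  then have "\<turnstile> (Var vb \<^bold>= Var vc) \<^bold>\<Rightarrow> Iff (?E \<^bold>\<Rightarrow> h) (?E \<^bold>\<Rightarrow> ?h)"
    by (rule taut1[OF var_inst_Iff[of vb vc h]]) (simp only: val_simps; blast)
  then have "\<turnstile> (Var vb \<^bold>= Var vc) \<^bold>\<Rightarrow> Iff (num_inst h va q) (num_inst ?h va q)"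
    unfolding num_inst_def by (rule imp_Iff_all) (simp add: va_def vb_def vc_def)
  then have "\<turnstile> (Var vb \<^bold>= Var vc) \<^bold>\<Rightarrow> (Var vc \<^bold>= \<lceil>k\<rceil>\<^sub>S) \<^bold>\<Rightarrow>
      Iff (num_inst ?h va q) (num_inst (num_inst h va q) vb k)"
  proof (rule provableI2[OF num_inst_eq_Iff[of vb k "num_inst h va q"]])
    fix v assume v: "val v" and "v ((Var vb \<^bold>= \<lceil>k\<rceil>\<^sub>S) \<^bold>\<Rightarrow> Iff (num_inst h va q) (num_inst (num_inst h va q) vb k))"
      and "v ((Var vb \<^bold>= Var vc) \<^bold>\<Rightarrow> Iff (num_inst h va q) (num_inst ?h va q))"
    then show "v ((Var vb \<^bold>= Var vc) \<^bold>\<Rightarrow> (Var vc \<^bold>= \<lceil>k\<rceil>\<^sub>S) \<^bold>\<Rightarrow>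
        Iff (num_inst ?h va q) (num_inst (num_inst h va q) vb k))"
      using val_eq_trans[OF v, of "Var vb" "Var vc" "\<lceil>k\<rceil>\<^sub>S"] by (simp only: val_simps; blast)
  qed
  then show ?thesis
    by (rule eq_elim)
      (use fv_var_inst[of h vb vc] in \<open>auto simp: fv_num_inst vb_def vc_def\<close>)
qed

context
  fixes g h :: fm and x :: var and q :: nat
  assumes fv_g: "fv g = {va, vb}" and fv_h: "fv h = {va, vb}" and x: "x \<notin> {vb, vc}"
begin

lemma fv_rosser_instances:
  "fv (num_inst g va q) = {vb}" "fv (num_inst (var_inst h vb vc) va q) \<subseteq> {vc}"
  using fv_var_inst[of h vb vc] fv_g fv_h by (auto simp: fv_num_inst va_def vb_def)

lemma rosser_refuted:
  assumes R: "\<turnstile> rosser_sentence g h x q" and g: "\<turnstile> num_inst (num_inst g va q) vb n"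
    and h: "\<And>k. k \<le> n \<Longrightarrow> \<turnstile> Neg (num_inst (num_inst h va q) vb k)"
  shows "\<not> S_consistent"
proof -
  let ?g = "num_inst g va q" and ?h = "num_inst (var_inst h vb vc) va q"
  let ?L = "leq_fm x (Var vc) \<lceil>n\<rceil>\<^sub>S"
  have "\<turnstile> ?g \<^bold>\<Rightarrow> Ex vc (leq_fm x (Var vc) (Var vb) \<^bold>\<and> ?h)"
    using provable_mp[OF R[unfolded rosser_sentence_def] all_elim] .
  from provable_subst[OF this, of "\<lceil>n\<rceil>\<^sub>S" vb]
  have inst: "\<turnstile> subst vb \<lceil>n\<rceil>\<^sub>S ?g \<^bold>\<Rightarrow> Ex vc (?L \<^bold>\<and> subst vb \<lceil>n\<rceil>\<^sub>S ?h)"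
    using x by (simp add: leq_fm_def vb_def vc_def)
  \<comment> \<open>In \<open>?h\<close> the variable \<open>vb\<close> has given way to
    \<open>vc\<close>, so within the existential formula the numeral enters only the order
    bound.\<close>
  have "vb \<notin> fv ?h"
    using fv_rosser_instances(2) by (auto simp: vb_def vc_def)
  then have h': "subst vb \<lceil>n\<rceil>\<^sub>S ?h = ?h" by (rule subst_fresh)
  have "\<turnstile> subst vb \<lceil>n\<rceil>\<^sub>S ?g"
    by (rule taut2[OF g num_inst_Iff]) (simp only: val_simps; blast)
  then have ex: "\<turnstile> Ex vc (?L \<^bold>\<and> ?h)"
    by (rule provable_mp[OF _ inst[unfolded h']])
  have "\<turnstile> ?L \<^bold>\<Rightarrow> Neg ?h"
  proof (rule leq_numeral_cases)
    fix k assume "k \<le> n"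
    then have "\<turnstile> Neg (num_inst (num_inst h va q) vb k)" by (rule h)
    then show "\<turnstile> (Var vc \<^bold>= \<lceil>k\<rceil>\<^sub>S) \<^bold>\<Rightarrow> Neg ?h"
      by (rule taut2[OF _ var_inst_eq_Iff[of k h q]]) (simp only: val_simps; blast)
  qed (use x fv_rosser_instances(2) in auto)
  \<comment> \<open>The existential rule needs a conclusion without \<open>vc\<close>; a refutable
    sentence takes the place of falsity.\<close>
  then have "\<turnstile> (?L \<^bold>\<and> ?h) \<^bold>\<Rightarrow> Neg (Zero \<^bold>= Zero)"
    by (rule taut1) (simp only: val_simps; blast)
  then have "\<turnstile> Ex vc (?L \<^bold>\<and> ?h) \<^bold>\<Rightarrow> Neg (Zero \<^bold>= Zero)"
    by (rule ex_impI) simp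
  with ex have "\<turnstile> Neg (Zero \<^bold>= Zero)" by (rule provable_mp)
  moreover have "\<turnstile> Zero \<^bold>= Zero" by (rule provableI) (rule val_eq_refl)
  ultimately show ?thesis by (auto simp: S_consistent_def)
qed

lemma rosser_proved:
  assumes h: "\<turnstile> num_inst (num_inst h va q) vb n"
    and g: "\<And>k. k \<le> n \<Longrightarrow> \<turnstile> Neg (num_inst (num_inst g va q) vb k)"
  shows "\<turnstile> rosser_sentence g h x q"
proof -
  let ?g = "num_inst g va q" and ?h = "num_inst (var_inst h vb vc) va q"
  let ?X = "Ex vc (leq_fm x (Var vc) (Var vb) \<^bold>\<and> ?h)"
  have "\<turnstile> ?g \<^bold>\<Rightarrow> ?X"
  proof (rule geq_numeral_cases)
    fix k assume "k < n"
    then have "\<turnstile> Neg (num_inst ?g vb k)" by (intro g) simp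
    then show "\<turnstile> (Var vb \<^bold>= \<lceil>k\<rceil>\<^sub>S) \<^bold>\<Rightarrow> ?g \<^bold>\<Rightarrow> ?X"
      by (rule taut2[OF _ num_inst_eq_Iff[of vb k ?g]]) (simp only: val_simps; blast)
  next
    have nvc: "vc \<notin> fv (num_inst (num_inst h va q) vb n)"
      using fv_h by (simp add: fv_num_inst vc_def)
    \<comment> \<open>With the numeral put for \<open>vc\<close>, the antecedent of
      \<open>var_inst_eq_Iff\<close> becomes reflexive, and its right side stays as it is.\<close>
    have "\<turnstile> (\<lceil>n\<rceil>\<^sub>S \<^bold>= \<lceil>n\<rceil>\<^sub>S) \<^bold>\<Rightarrow> Iff (subst vc \<lceil>n\<rceil>\<^sub>S ?h) (num_inst (num_inst h va q) vb n)"
      using provable_subst[OF var_inst_eq_Iff[of n h q], of "\<lceil>n\<rceil>\<^sub>S" vc] subst_fresh[OF nvc] by simp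
    then have 1: "\<turnstile> subst vc \<lceil>n\<rceil>\<^sub>S ?h"
      by (rule provableI2[OF h]) (auto simp: val_simps val_eq_refl)
    have 2: "\<turnstile> (leq_fm x \<lceil>n\<rceil>\<^sub>S (Var vb) \<^bold>\<and> subst vc \<lceil>n\<rceil>\<^sub>S ?h) \<^bold>\<Rightarrow> ?X"
      using provable_ax[OF ax.intros(13)[of "\<lceil>n\<rceil>\<^sub>S" vc "leq_fm x (Var vc) (Var vb) \<^bold>\<and> ?h"]] x
      by (simp add: leq_fm_def vb_def vc_def)
    show "\<turnstile> leq_fm x \<lceil>n\<rceil>\<^sub>S (Var vb) \<^bold>\<Rightarrow> ?g \<^bold>\<Rightarrow> ?X"
      by (rule taut2[OF 1 2]) (simp only: val_simps; blast)
  qed (use x fv_rosser_instances in \<open>auto simp: leq_fm_def\<close>)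
  then show ?thesis
    unfolding rosser_sentence_def by (rule generalize)
qed

lemma fv_rosser_fm: "fv (rosser_fm g h x) = {va}"
  using fv_var_inst[of h vb vc] fv_g fv_h by (auto simp: rosser_fm_def leq_fm_def va_def vb_def vc_def)

end

theorem theorem3p6:
  fixes g h :: fm and x :: var and q :: nat
  assumes "S_consistent"
    and "fv g = {va, vb}" and "numeralwise_expresses g va vb G_pred"
    and "fv h = {va, vb}" and "numeralwise_expresses h va vb H_pred"
    and "x \<notin> {vb, vc}"
    and "q = gnum (fm_expr (rosser_fm g h x))"
  shows "\<forall>R \<in> {rosser_sentence g h x q, num_inst (rosser_fm g h x) va q}.
           \<not> (\<turnstile> R) \<and> \<not> (\<turnstile> Neg R)"
proof -
  let ?R = "rosser_sentence g h x q" and ?A = "rosser_fm g h x"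
  \<comment> \<open>G and H refer to this form, the two halves of the argument to \<open>?R\<close>;
    provability is carried across by \<open>iff\<close>.\<close>
  let ?R' = "num_inst ?A va q"
  note fv = fv_rosser_fm[OF assms(2,4,6)]
  \<comment> \<open>The number \<open>q\<close> determines the formula, and \<open>va\<close> is its
    only free variable; the existential quantifiers in G and H over formula and variable thus
    collapse.\<close>
  have unique: "A = ?A \<and> y = va" if "gnum (fm_expr A) = q" "fv A = {y}" for A y
    using that gnum_fm_expr_inj[of A ?A] fv assms(7) by auto
  have G: "G_pred q b \<longleftrightarrow> (\<exists>fs. gnum (proof_expr fs) = b \<and> is_proof_of fs ?R')" for b
    unfolding G_pred_def using unique fv assms(7) by blast
  have H: "H_pred q b \<longleftrightarrow> (\<exists>fs. gnum (proof_expr fs) = b \<and> is_proof_of fs (Neg ?R'))" for b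
    unfolding H_pred_def using unique fv assms(7) by blast
  note Iff = rosser_sentence_Iff[of g h x q]
  have "\<turnstile> ?R'" if "\<turnstile> ?R"
    by (rule taut2[OF Iff that]) (simp only: val_simps; blast)
  moreover have "\<turnstile> ?R" if "\<turnstile> ?R'"
    by (rule taut2[OF Iff that]) (simp only: val_simps; blast)
  moreover have "\<turnstile> Neg ?R'" if "\<turnstile> Neg ?R"
    by (rule taut2[OF Iff that]) (simp only: val_simps; blast)
  moreover have "\<turnstile> Neg ?R" if "\<turnstile> Neg ?R'"
    by (rule taut2[OF Iff that]) (simp only: val_simps; blast)
  ultimately have iff: "\<turnstile> ?R \<longleftrightarrow> \<turnstile> ?R'" "\<turnstile> Neg ?R \<longleftrightarrow> \<turnstile> Neg ?R'"
    by blast+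
  have no: False if "\<turnstile> B" "\<turnstile> Neg B" for B
    using that assms(1) by (auto simp: S_consistent_def)
  have "\<not> \<turnstile> ?R'"
  proof
    assume R': "\<turnstile> ?R'"
    then obtain b where b: "G_pred q b" by (auto simp: G provable_def)
    \<comment> \<open>A proof of the negation beside that of \<open>?R'\<close> would violate
      consistency, so \<open>H_pred\<close> fails at every number.\<close>
    have "\<not> H_pred q k" for k
      using R' no by (auto simp: H provable_def)
    then have "\<not> S_consistent"
      using R' b assms(3,5) iff
      by (intro rosser_refuted[OF assms(2,4,6), of q b]) (auto simp: numeralwise_expresses_def)
    with assms(1) show False by simp
  qed
  moreover have "\<not> \<turnstile> Neg ?R'"
  proof
    assume R': "\<turnstile> Neg ?R'"
    then obtain b where b: "H_pred q b" by (auto simp: H provable_def)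
    have "\<not> G_pred q k" for k
      using R' no by (auto simp: G provable_def)
    then have "\<turnstile> ?R"
      using b assms(3,5)
      by (intro rosser_proved[OF assms(2,4,6), of q b]) (auto simp: numeralwise_expresses_def)
    with R' iff no show False by blast
  qed
  ultimately show ?thesis
    using iff by simp
qed

end
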